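(* Extension Roman Hitting Function is fixed-parameter tractable when parameterized by $\omega(2-f)=\sum_{x\in X}(2-f(x))$, and also when parameterized by $|f^{-1}(\{0,1\})|$.
   Context: A hypergraph is $H=(X,(s_i)_{i\in I})$ with finite $X$, finite index set $I$, $s_i\subseteq X$ (repetitions allowed). A correspondence is a map $\tau:X\to I$ with $x\in s_{\tau(x)}$ for all $x$. A function $g:X\to\{0,1,2\}$ is a Roman hitting function (rhf) if for every $i\in I$ there is $x\in s_i$ with $g(x)=2$ or there is $x$ with $\tau(x)=i$ and $g(x)=1$. Functions are ordered pointwise; an rhf $g$ is minimal if every rhf $h\le g$ equals $g$. Extension Roman Hitting Function: given $H$, $\tau$ and $f:X\to\{0,1,2\}$, decide whether there is a minimal rhf $g$ with $f\le g$. *)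

theory Defs
  imports "HOL-Library.FuncSet" "HOL-Computational_Algebra.Polynomial"
begin

section \<open>Roman hitting functions\<close>

text \<open>Functions with domain \<open>X\<close> are taken to be extensional (\<open>\<rightarrow>\<^sub>E\<close>), so that HOL equality is
  equality of functions on \<open>X\<close>.\<close>

definition hypergraph :: "'x set \<Rightarrow> 'i set \<Rightarrow> ('i \<Rightarrow> 'x set) \<Rightarrow> bool" where
  "hypergraph X I s \<longleftrightarrow> finite X \<and> finite I \<and> s \<in> I \<rightarrow>\<^sub>E Pow X"

definition correspondence :: "'x set \<Rightarrow> 'i set \<Rightarrow> ('i \<Rightarrow> 'x set) \<Rightarrow> ('x \<Rightarrow> 'i) \<Rightarrow> bool" where
  "correspondence X I s \<tau> \<longleftrightarrow> \<tau> \<in> X \<rightarrow>\<^sub>E I \<and> (\<forall>x\<in>X. x \<in> s (\<tau> x))"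

definition rhf ::
  "'x set \<Rightarrow> 'i set \<Rightarrow> ('i \<Rightarrow> 'x set) \<Rightarrow> ('x \<Rightarrow> 'i) \<Rightarrow> ('x \<Rightarrow> nat) \<Rightarrow> bool" where
  "rhf X I s \<tau> g \<longleftrightarrow> g \<in> X \<rightarrow>\<^sub>E {0, 1, 2} \<and>
     (\<forall>i\<in>I. (\<exists>x\<in>s i. g x = 2) \<or> (\<exists>x\<in>X. \<tau> x = i \<and> g x = 1))"

definition minimal_rhf ::
  "'x set \<Rightarrow> 'i set \<Rightarrow> ('i \<Rightarrow> 'x set) \<Rightarrow> ('x \<Rightarrow> 'i) \<Rightarrow> ('x \<Rightarrow> nat) \<Rightarrow> bool" where
  "minimal_rhf X I s \<tau> g \<longleftrightarrow> rhf X I s \<tau> g \<and>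
     (\<forall>h. rhf X I s \<tau> h \<and> (\<forall>x\<in>X. h x \<le> g x) \<longrightarrow> h = g)"

definition rhf_extendable ::
  "'x set \<Rightarrow> 'i set \<Rightarrow> ('i \<Rightarrow> 'x set) \<Rightarrow> ('x \<Rightarrow> 'i) \<Rightarrow> ('x \<Rightarrow> nat) \<Rightarrow> bool" where
  "rhf_extendable X I s \<tau> f \<longleftrightarrow> (\<exists>g. minimal_rhf X I s \<tau> g \<and> (\<forall>x\<in>X. f x \<le> g x))"

definition weight_two_minus :: "'x set \<Rightarrow> ('x \<Rightarrow> nat) \<Rightarrow> nat" where
  "weight_two_minus X f = (\<Sum>x\<in>X. 2 - f x)"

definition num_below_two :: "'x set \<Rightarrow> ('x \<Rightarrow> nat) \<Rightarrow> nat" where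
  "num_below_two X f = card {x \<in> X. f x \<in> {0, 1}}"


section \<open>Random access machines\<close>

text \<open>Registers \<open>0, 1, 2, \<dots>\<close> hold natural numbers and are initially \<open>0\<close>; the input is a
  read-only bit string. Every instruction has unit cost. As the only arithmetic operations are
  addition and (truncated) subtraction, \<open>t\<close> steps produce numbers of \<open>O(t)\<close> bits only, so that
  running times are polynomially related to those of Turing machines. The machine halts when the
  program counter leaves the program; the output is the content of register \<open>0\<close>.\<close>

datatype instr =
    Const nat nat      \<comment> \<open>\<open>R\<^sub>r := k\<close>\<close>
  | Add nat nat nat    \<comment> \<open>\<open>R\<^sub>r := R\<^sub>a + R\<^sub>b\<close>\<close>
  | Sub nat nat nat    \<comment> \<open>\<open>R\<^sub>r := R\<^sub>a - R\<^sub>b\<close>\<close>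
  | Load nat nat       \<comment> \<open>\<open>R\<^sub>r\<close> := contents of the register with number \<open>R\<^sub>a\<close>\<close>
  | Store nat nat      \<comment> \<open>register with number \<open>R\<^sub>a\<close> := \<open>R\<^sub>b\<close>\<close>
  | Read nat nat       \<comment> \<open>\<open>R\<^sub>r\<close> := input symbol at position \<open>R\<^sub>a\<close>, or \<open>2\<close> past the end of the input\<close>
  | JumpZero nat nat   \<comment> \<open>go to \<open>l\<close> if \<open>R\<^sub>r = 0\<close>\<close>
  | Jump nat

type_synonym config = "nat \<times> (nat \<Rightarrow> nat)"

definition input_symbol :: "bool list \<Rightarrow> nat \<Rightarrow> nat" where
  "input_symbol w j = (if j < length w then of_bool (w ! j) else 2)"

fun exec_instr :: "bool list \<Rightarrow> instr \<Rightarrow> config \<Rightarrow> config" where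
  "exec_instr w (Const r k) (pc, R) = (Suc pc, R(r := k))"
| "exec_instr w (Add r a b) (pc, R) = (Suc pc, R(r := R a + R b))"
| "exec_instr w (Sub r a b) (pc, R) = (Suc pc, R(r := R a - R b))"
| "exec_instr w (Load r a) (pc, R) = (Suc pc, R(r := R (R a)))"
| "exec_instr w (Store a b) (pc, R) = (Suc pc, R(R a := R b))"
| "exec_instr w (Read r a) (pc, R) = (Suc pc, R(r := input_symbol w (R a)))"
| "exec_instr w (JumpZero r l) (pc, R) = (if R r = 0 then l else Suc pc, R)"
| "exec_instr w (Jump l) (pc, R) = (l, R)"

definition ram_step :: "instr list \<Rightarrow> bool list \<Rightarrow> config \<Rightarrow> config" where
  "ram_step P w c = (if fst c < length P then exec_instr w (P ! fst c) c else c)"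

text \<open>Since halted configurations are fixed points of \<^const>\<open>ram_step\<close>, the following says that
  \<open>P\<close> halts on \<open>w\<close> after at most \<open>t\<close> steps, with output \<open>v\<close>.\<close>

definition outputs_within :: "instr list \<Rightarrow> bool list \<Rightarrow> nat \<Rightarrow> nat \<Rightarrow> bool" where
  "outputs_within P w t v \<longleftrightarrow>
     (let (pc, R) = (ram_step P w ^^ t) (0, \<lambda>_. 0) in length P \<le> pc \<and> R 0 = v)"


section \<open>Fixed-parameter tractability\<close>

definition ram_computable :: "(nat \<Rightarrow> nat) \<Rightarrow> bool" where
  "ram_computable \<phi> \<longleftrightarrow> (\<exists>P. \<forall>k. \<exists>t. outputs_within P (replicate k True) t (\<phi> k))"

definition poly_time_computable :: "(bool list \<Rightarrow> nat) \<Rightarrow> bool" where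
  "poly_time_computable \<kappa> \<longleftrightarrow>
     (\<exists>P (p :: nat poly). \<forall>w. outputs_within P w (poly p (length w)) (\<kappa> w))"

text \<open>A parameterized problem consists of a language \<open>L\<close> of bit strings and a polynomial-time
  computable parameterization \<open>\<kappa>\<close> (Flum and Grohe).\<close>

definition fpt :: "bool list set \<Rightarrow> (bool list \<Rightarrow> nat) \<Rightarrow> bool" where
  "fpt L \<kappa> \<longleftrightarrow> poly_time_computable \<kappa> \<and>
     (\<exists>P \<phi> (p :: nat poly). ram_computable \<phi> \<and>
        (\<forall>w. outputs_within P w (\<phi> (\<kappa> w) * poly p (length w)) (if w \<in> L then 1 else 0)))"


section \<open>Extension Roman Hitting Function as a problem on bit strings\<close>

text \<open>Up to renaming, \<open>X = {..<n}\<close> and \<open>I = {..<m}\<close>.\<close>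

record erhf_instance =
  num_vertices :: nat
  num_edges :: nat
  edge_sets :: "nat \<Rightarrow> nat set"
  corr :: "nat \<Rightarrow> nat"
  base_fun :: "nat \<Rightarrow> nat"

definition verts :: "erhf_instance \<Rightarrow> nat set" where
  "verts E = {..<num_vertices E}"

definition edges :: "erhf_instance \<Rightarrow> nat set" where
  "edges E = {..<num_edges E}"

definition erhf_instances :: "erhf_instance set" where
  "erhf_instances = {E. hypergraph (verts E) (edges E) (edge_sets E) \<and>
     correspondence (verts E) (edges E) (edge_sets E) (corr E) \<and>
     base_fun E \<in> verts E \<rightarrow>\<^sub>E {0, 1, 2}}"

definition erhf_yes :: "erhf_instance \<Rightarrow> bool" where
  "erhf_yes E \<longleftrightarrow> rhf_extendable (verts E) (edges E) (edge_sets E) (corr E) (base_fun E)"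

definition unary :: "nat \<Rightarrow> bool list" where
  "unary k = replicate k True @ [False]"

text \<open>The numbers \<open>n\<close> and \<open>m\<close>, the incidence matrix, and the value tables of \<open>\<tau>\<close> and \<open>f\<close>. All
  entries are at most \<open>max n m\<close> or \<open>2\<close>, so writing them in unary keeps the length polynomial.\<close>

definition erhf_code :: "erhf_instance \<Rightarrow> nat list" where
  "erhf_code E =
     [num_vertices E, num_edges E] @
     concat (map (\<lambda>i. map (\<lambda>x. of_bool (x \<in> edge_sets E i)) [0..<num_vertices E]) [0..<num_edges E]) @
     map (corr E) [0..<num_vertices E] @
     map (base_fun E) [0..<num_vertices E]"

definition erhf_encode :: "erhf_instance \<Rightarrow> bool list" where
  "erhf_encode E = concat (map unary (erhf_code E))"

definition erhf_language :: "bool list set" where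
  "erhf_language = erhf_encode ` {E \<in> erhf_instances. erhf_yes E}"

text \<open>Strings that encode no instance get parameter \<open>0\<close>.\<close>

definition erhf_parameter :: "(erhf_instance \<Rightarrow> nat) \<Rightarrow> bool list \<Rightarrow> nat" where
  "erhf_parameter \<kappa> w =
     (if w \<in> erhf_encode ` erhf_instances
      then \<kappa> (inv_into erhf_instances erhf_encode w) else 0)"

lemma unary_append_eq_iff: "unary a @ u = unary b @ v \<longleftrightarrow> a = b \<and> u = v"
proof (induction a arbitrary: b)
  case 0
  show ?case by (cases b) (auto simp: unary_def)
next
  case (Suc a)
  then show ?case by (cases b) (auto simp: unary_def)
qed

lemma unary_neq_Nil: "unary a \<noteq> []"
  by (simp add: unary_def)

lemma concat_unary_inj: "concat (map unary xs) = concat (map unary ys) \<longleftrightarrow> xs = ys"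
proof (induction xs arbitrary: ys)
  case Nil
  show ?case by (cases ys) (auto simp: unary_neq_Nil)
next
  case (Cons a xs)
  then show ?case by (cases ys) (auto simp: unary_neq_Nil unary_append_eq_iff)
qed

lemma concat_map_upt_eqD:
  assumes "concat (map (\<lambda>i. map (F i) [0..<n]) [0..<m]) = concat (map (\<lambda>i. map (G i) [0..<n]) [0..<m])"
    and "i < m" and "x < (n::nat)"
  shows "F i x = G i x"
  using assms
proof (induction m)
  case (Suc m)
  have "length (concat (map (\<lambda>i. map (F i) [0..<n]) [0..<m])) =
        length (concat (map (\<lambda>i. map (G i) [0..<n]) [0..<m]))"
    by (simp add: length_concat comp_def)
  then show ?case
    using Suc by (auto simp: less_Suc_eq)
qed simp

theorem inj_on_erhf_encode: "inj_on erhf_encode erhf_instances"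
proof (rule inj_onI)
  fix E E'
  assume E: "E \<in> erhf_instances" and E': "E' \<in> erhf_instances"
    and "erhf_encode E = erhf_encode E'"
  then have code: "erhf_code E = erhf_code E'"
    by (simp add: erhf_encode_def concat_unary_inj)
  then have n: "num_vertices E = num_vertices E'" and m: "num_edges E = num_edges E'"
    by (simp_all add: erhf_code_def)
  let ?n = "num_vertices E'" and ?m = "num_edges E'"
  let ?M = "\<lambda>E. concat (map (\<lambda>i. map (\<lambda>x. of_bool (x \<in> edge_sets E i) :: nat) [0..<?n]) [0..<?m])"
  have len: "length (?M E) = length (?M E')"
    by (simp add: length_concat comp_def)
  have "?M E @ map (corr E) [0..<?n] @ map (base_fun E) [0..<?n] =
        ?M E' @ map (corr E') [0..<?n] @ map (base_fun E') [0..<?n]"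
    using code n m by (simp add: erhf_code_def)
  with len have M: "?M E = ?M E'"
    and c: "map (corr E) [0..<?n] = map (corr E') [0..<?n]"
    and b: "map (base_fun E) [0..<?n] = map (base_fun E') [0..<?n]"
    by simp_all
  have mem: "x \<in> edge_sets E i \<longleftrightarrow> x \<in> edge_sets E' i" if "i < ?m" "x < ?n" for i x
    using concat_map_upt_eqD[OF M that] by (simp add: of_bool_def split: if_splits)
  have s: "edge_sets E \<in> {..<?m} \<rightarrow>\<^sub>E Pow {..<?n}" "edge_sets E' \<in> {..<?m} \<rightarrow>\<^sub>E Pow {..<?n}"
    using E E' n m by (simp_all add: erhf_instances_def hypergraph_def verts_def edges_def)
  have "edge_sets E = edge_sets E'"
  proof (rule PiE_ext[OF s])
    fix i assume i: "i \<in> {..<?m}"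
    have "edge_sets E i \<subseteq> {..<?n}" "edge_sets E' i \<subseteq> {..<?n}"
      using PiE_mem[OF s(1) i] PiE_mem[OF s(2) i] by simp_all
    with mem i show "edge_sets E i = edge_sets E' i"
      by blast
  qed
  moreover have "corr E = corr E'"
    using E E' n m c by (intro PiE_ext[of _ "{..<?n}" "\<lambda>_. {..<?m}"])
      (auto simp: erhf_instances_def correspondence_def verts_def edges_def)
  moreover have "base_fun E = base_fun E'"
    using E E' n m b by (intro PiE_ext[of _ "{..<?n}" "\<lambda>_. {0, 1, 2}"])
      (auto simp: erhf_instances_def verts_def)
  ultimately show "E = E'"
    using n m by simp
qed

end

theory Submission imports Defs begin

text \<open>If \<open>k\<close> vertices have \<open>f x < 2\<close>, then at most \<open>3 ^ k\<close> functions lie between \<open>f\<close> and the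
  constant \<open>2\<close>, and \<open>k\<close> is at most either parameter; so it suffices to test each of them for
  being a minimal rhf in polynomial time. Since \<open>x \<in> s (\<tau> x)\<close>, raising values
  preserves the rhf property, hence an rhf \<open>g\<close> is minimal iff lowering any single positive value
  of \<open>g\<close> by one destroys the property.

  The random access machine parses and validates its input, and then steps through the candidates
  like an odometer, with vertex \<open>x\<close> as a digit that runs from \<open>f x\<close> to \<open>2\<close>. Every test is the
  evaluation of an arithmetic expression with sums bounded by the numbers of vertices and
  hyperedges, which a single compiler correctness proof shows to take polynomial time.\<close>

section \<open>Structured programs\<close>

text \<open>The definition of \<open>fpt\<close> asks for concrete machine programs with step
  counts, so most of the work is program verification. Expressions have no early exit, hence their
  running time depends only on the limits of their sums, and these are at most the input length
  because the numbers of vertices and hyperedges are written in unary. Explicit \<open>while\<close>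
  loops remain only for reading the input, for copying \<open>f\<close> and for the odometer. The
  machine cannot multiply; the addresses \<open>2 + i * n + x\<close> of the incidence matrix obtain
  the product from a sum. The parameter occurs in no step of the decision program: the factor
  \<open>3 ^ k\<close> merely bounds its number of rounds, so one program serves both
  parameterizations. A separate program evaluates the parameter, which has to be computable in
  polynomial time.\<close>

type_synonym store = "nat \<Rightarrow> nat"

text \<open>In \<open>Loop p r c\<close> the code \<open>p\<close> recomputes the guard register
  \<open>r\<close> before every test, since a guard is in general a whole expression.\<close>

datatype code =
    Ins instr
  | Seq code code (infixr \<open>;;\<close> 60)
  | Cond nat code code
  | Loop code nat code

fun code_len :: "code \<Rightarrow> nat" where
  "code_len (Ins i) = 1"
| "code_len (c ;; d) = code_len c + code_len d"
| "code_len (Cond r c d) = code_len c + code_len d + 2"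
| "code_len (Loop p r c) = code_len p + code_len c + 2"

text \<open>Jump targets are absolute, so the address \<open>l\<close> of the first instruction is a
  parameter.\<close>

fun assemble :: "nat \<Rightarrow> code \<Rightarrow> instr list" where
  "assemble l (Ins i) = [i]"
| "assemble l (c ;; d) = assemble l c @ assemble (l + code_len c) d"
| "assemble l (Cond r c d) =
     JumpZero r (l + code_len c + 2) # assemble (l + 1) c @
     Jump (l + code_len c + code_len d + 2) # assemble (l + code_len c + 2) d"
| "assemble l (Loop p r c) =
     assemble l p @ JumpZero r (l + code_len p + code_len c + 2) #
     assemble (l + code_len p + 1) c @ [Jump l]"

lemma length_assemble [simp]: "length (assemble l c) = code_len c"
  by (induction c arbitrary: l) auto

fun is_jump :: "instr \<Rightarrow> bool" where
  "is_jump (JumpZero r l) = True"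
| "is_jump (Jump l) = True"
| "is_jump _ = False"

text \<open>Step counts are exact: 2 extra for the first branch of \<open>Cond\<close> (test and
  jump), 1 for the second, 2 for each completed loop round. Instructions that do not jump change the
  registers independently of the program counter, hence the dummy counter 0.\<close>

inductive exec :: "bool list \<Rightarrow> code \<Rightarrow> store \<Rightarrow> nat \<Rightarrow> store \<Rightarrow> bool" for w where
  exec_Ins: "\<not> is_jump i \<Longrightarrow> exec w (Ins i) R 1 (snd (exec_instr w i (0, R)))"
| exec_Seq: "exec w c R t R' \<Longrightarrow> exec w d R' t' R'' \<Longrightarrow> exec w (c ;; d) R (t + t') R''"
| exec_Cond_true: "R r \<noteq> 0 \<Longrightarrow> exec w c R t R' \<Longrightarrow> exec w (Cond r c d) R (t + 2) R'"
| exec_Cond_false: "R r = 0 \<Longrightarrow> exec w d R t R' \<Longrightarrow> exec w (Cond r c d) R (t + 1) R'"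
| exec_Loop_exit: "exec w p R t R' \<Longrightarrow> R' r = 0 \<Longrightarrow> exec w (Loop p r c) R (t + 1) R'"
| exec_Loop_step: "exec w p R t R' \<Longrightarrow> R' r \<noteq> 0 \<Longrightarrow> exec w c R' t' R'' \<Longrightarrow>
    exec w (Loop p r c) R'' t'' R''' \<Longrightarrow> exec w (Loop p r c) R (t + t' + t'' + 2) R'''"

section \<open>Correctness of assembled machine programs\<close>

definition code_at :: "instr list \<Rightarrow> nat \<Rightarrow> instr list \<Rightarrow> bool" where
  "code_at P l xs \<longleftrightarrow> (\<exists>us vs. P = us @ xs @ vs \<and> length us = l)"

lemma code_at_append:
  assumes "code_at P l (xs @ ys)"
  shows "code_at P l xs" "code_at P (l + length xs) ys"
proof -
  obtain us vs where "P = us @ (xs @ ys) @ vs" "length us = l"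
    using assms by (auto simp: code_at_def)
  then have "P = us @ xs @ (ys @ vs)" "P = (us @ xs) @ ys @ vs" "length (us @ xs) = l + length xs"
    by auto
  then show "code_at P l xs" "code_at P (l + length xs) ys"
    using \<open>length us = l\<close> unfolding code_at_def by blast+
qed

lemma code_at_Cons:
  assumes "code_at P l (x # xs)"
  shows "P ! l = x" "l < length P" "code_at P (l + 1) xs"
proof -
  show "P ! l = x" "l < length P"
    using assms by (auto simp: code_at_def)
  show "code_at P (l + 1) xs"
    using code_at_append(2)[of P l "[x]" xs] assms by simp
qed

lemma funpow_trans:
  "(f ^^ s) x = y \<Longrightarrow> (f ^^ t) y = z \<Longrightarrow> (f ^^ (s + t)) x = z"
  by (metis add.commute comp_apply funpow_add)

lemma ram_step_at:
  "code_at P l (i # xs) \<Longrightarrow> ram_step P w (l, R) = exec_instr w i (l, R)"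
  by (auto simp: ram_step_def dest: code_at_Cons)

lemma exec_instr_no_jump:
  "\<not> is_jump i \<Longrightarrow> exec_instr w i (l, R) = (Suc l, snd (exec_instr w i (0, R)))"
  by (cases i) auto

text \<open>Induction on the derivation, not on the code: after a round of a loop the machine is
  back at address \<open>l\<close>, and the remaining rounds are a smaller derivation for the same
  code.\<close>

lemma exec_assemble:
  assumes "exec w c R t R'" "code_at P l (assemble l c)"
  shows "(ram_step P w ^^ t) (l, R) = (l + code_len c, R')"
  using assms
proof (induction arbitrary: l rule: exec.induct)
  case (exec_Ins i R)
  then show ?case
    using exec_instr_no_jump[of i w l R] ram_step_at[of P l i "[]" w R] by simp
next
  case (exec_Seq c R t R' d t' R'')
  have "code_at P l (assemble l c)" "code_at P (l + code_len c) (assemble (l + code_len c) d)"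
    using exec_Seq.prems code_at_append[of P l "assemble l c"] by auto
  from funpow_trans[OF exec_Seq.IH(1)[OF this(1)] exec_Seq.IH(2)[OF this(2)]]
  show ?case by (simp add: add.assoc)
next
  case (exec_Cond_true R r c t R' d)
  note at = exec_Cond_true.prems[simplified]
  have s1: "(ram_step P w ^^ 1) (l, R) = (l + 1, R)"
    using ram_step_at[OF at] exec_Cond_true.hyps by simp
  note at' = code_at_Cons(3)[OF at]
  have "code_at P (l + 1) (assemble (l + 1) c)"
    using code_at_append(1)[OF at'] by simp
  note s2 = exec_Cond_true.IH[OF this]
  have s3: "(ram_step P w ^^ 1) (l + 1 + code_len c, R') = (l + code_len c + code_len d + 2, R')"
    using ram_step_at[OF code_at_append(2)[OF at']] by simp
  show ?case
    using funpow_trans[OF s1 funpow_trans[OF s2 s3]] by (simp add: add_ac)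
next
  case (exec_Cond_false R r d t R' c)
  note at = exec_Cond_false.prems[simplified]
  have s1: "(ram_step P w ^^ 1) (l, R) = (l + code_len c + 2, R)"
    using ram_step_at[OF at] exec_Cond_false.hyps by simp
  have "code_at P (l + code_len c + 2) (assemble (l + code_len c + 2) d)"
    using code_at_Cons(3)[OF code_at_append(2)[OF code_at_Cons(3)[OF at]]] by (simp add: add_ac)
  note s2 = exec_Cond_false.IH[OF this]
  show ?case
    using funpow_trans[OF s1 s2] by (simp add: add_ac)
next
  case (exec_Loop_exit p R t R' r c)
  note at = exec_Loop_exit.prems[simplified]
  note s1 = exec_Loop_exit.IH[OF code_at_append(1)[OF at]]
  have s2: "(ram_step P w ^^ 1) (l + code_len p, R') = (l + code_len p + code_len c + 2, R')"
    using ram_step_at[OF code_at_append(2)[OF at]] exec_Loop_exit.hyps by simp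
  show ?case
    using funpow_trans[OF s1 s2] by (simp add: add_ac)
next
  case (exec_Loop_step p R t R' r c t' R'' t'' R''')
  note at = exec_Loop_step.prems[simplified]
  note s1 = exec_Loop_step.IH(1)[OF code_at_append(1)[OF at]]
  have s2: "(ram_step P w ^^ 1) (l + code_len p, R') = (l + code_len p + 1, R')"
    using ram_step_at[OF code_at_append(2)[OF at]] exec_Loop_step.hyps by simp
  note at' = code_at_Cons(3)[OF code_at_append(2)[OF at]]
  have "code_at P (l + code_len p + 1) (assemble (l + code_len p + 1) c)"
    using code_at_append(1)[OF at'] by simp
  note s3 = exec_Loop_step.IH(2)[OF this]
  have s4: "(ram_step P w ^^ 1) (l + code_len p + 1 + code_len c, R'') = (l, R'')"
    using ram_step_at[OF code_at_append(2)[OF at']] by simp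
  note s5 = exec_Loop_step.IH(3)[OF exec_Loop_step.prems]
  show ?case
    using funpow_trans[OF s1 funpow_trans[OF s2 funpow_trans[OF s3 funpow_trans[OF s4 s5]]]]
    by (simp add: add_ac)
qed

lemma outputs_within_assemble:
  assumes "exec w c (\<lambda>_. 0) t R" "t \<le> t'"
  shows "outputs_within (assemble 0 c) w t' (R 0)"
proof -
  let ?P = "assemble 0 c"
  have "code_at ?P 0 ?P" by (auto simp: code_at_def)
  from exec_assemble[OF assms(1) this]
  have "(ram_step ?P w ^^ t) (0, \<lambda>_. 0) = (code_len c, R)" by simp
  \<comment> \<open>The counter \<open>code_len c\<close> lies just past the program, so the machine
    has halted and surplus steps change nothing.\<close>
  moreover have "(ram_step ?P w ^^ s) (code_len c, R) = (code_len c, R)" for s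
    by (induction s) (auto simp: ram_step_def)
  ultimately have "(ram_step ?P w ^^ (t + (t' - t))) (0, \<lambda>_. 0) = (code_len c, R)"
    using funpow_trans by metis
  then show ?thesis
    using assms(2) by (simp add: outputs_within_def)
qed


section \<open>Expressions with bounded sums\<close>

datatype expr =
    Num nat
  | Var nat
  | Plus expr expr
  | Minus expr expr
  | Arr expr
  | Sum nat nat expr   \<comment> \<open>\<open>Sum x y e\<close> is the sum of \<open>e\<close> over \<open>x < y\<close>\<close>

fun val :: "store \<Rightarrow> store \<Rightarrow> expr \<Rightarrow> nat" where
  "val v a (Num k) = k"
| "val v a (Var x) = v x"
| "val v a (Plus e f) = val v a e + val v a f"
| "val v a (Minus e f) = val v a e - val v a f"
| "val v a (Arr e) = a (val v a e)"
| "val v a (Sum x y e) = (\<Sum>k<v y. val (v(x := k)) a e)"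

text \<open>These are the limits of sums, not the summation variables: if they are at most
  \<open>N\<close>, then \<open>cost N e\<close> bounds the time. The variable \<open>x\<close> may
  be dropped because its values stay below that of the limit \<open>y\<close>.\<close>

fun bound_vars :: "expr \<Rightarrow> nat set" where
  "bound_vars (Num k) = {}"
| "bound_vars (Var x) = {}"
| "bound_vars (Plus e f) = bound_vars e \<union> bound_vars f"
| "bound_vars (Minus e f) = bound_vars e \<union> bound_vars f"
| "bound_vars (Arr e) = bound_vars e"
| "bound_vars (Sum x y e) = insert y (bound_vars e - {x})"

text \<open>Variables live in registers below 20, array entry \<open>j\<close> in register \<open>100 + j\<close>; the registers
  in between hold intermediate results, \<open>d\<close> being the first free one.\<close>

fun fits :: "nat \<Rightarrow> expr \<Rightarrow> bool" where
  "fits d (Num k) \<longleftrightarrow> d < 100"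
| "fits d (Var x) \<longleftrightarrow> x < 20 \<and> d < 100"
| "fits d (Plus e f) \<longleftrightarrow> fits d e \<and> fits (d + 1) f"
| "fits d (Minus e f) \<longleftrightarrow> fits d e \<and> fits (d + 1) f"
| "fits d (Arr e) \<longleftrightarrow> fits d e \<and> d + 1 < 100"
| "fits d (Sum x y e) \<longleftrightarrow> x < 20 \<and> y < 20 \<and> fits (d + 3) e"

text \<open>For a sum, register \<open>d\<close> accumulates, \<open>d + 1\<close> saves the old
  value of \<open>x\<close>, \<open>d + 2\<close> copies the limit, and \<open>d + 3\<close> holds
  in turn the guard (limit minus \<open>x\<close>) and the summand. The register of \<open>x\<close>
  itself counts, hence the saving and restoring. Copying is done by adding a register that holds
  0.\<close>

fun expr_code :: "nat \<Rightarrow> expr \<Rightarrow> code" where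
  "expr_code d (Num k) = Ins (Const d k)"
| "expr_code d (Var x) = Ins (Const d 0) ;; Ins (Add d d x)"
| "expr_code d (Plus e f) = expr_code d e ;; expr_code (d + 1) f ;; Ins (Add d d (d + 1))"
| "expr_code d (Minus e f) = expr_code d e ;; expr_code (d + 1) f ;; Ins (Sub d d (d + 1))"
| "expr_code d (Arr e) = expr_code d e ;; Ins (Const (d + 1) 100) ;; Ins (Add d d (d + 1)) ;;
     Ins (Load d d)"
| "expr_code d (Sum x y e) =
     Ins (Const d 0) ;; Ins (Add (d + 1) d x) ;; Ins (Add (d + 2) d y) ;; Ins (Const x 0) ;;
     Loop (Ins (Sub (d + 3) (d + 2) x)) (d + 3)
       (expr_code (d + 3) e ;; Ins (Add d d (d + 3)) ;; Ins (Const (d + 3) 1) ;;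
        Ins (Add x x (d + 3))) ;;
     Ins (Const (d + 3) 0) ;; Ins (Add x (d + 1) (d + 3))"

text \<open>A round of a sum spends 6 steps besides the summand: guard, test, jump back,
  accumulation and two for the counter. The further 8 are four for preparation, two for the last
  guard and test, two for restoring \<open>x\<close>.\<close>

fun cost :: "nat \<Rightarrow> expr \<Rightarrow> nat" where
  "cost N (Num k) = 1"
| "cost N (Var x) = 2"
| "cost N (Plus e f) = cost N e + cost N f + 1"
| "cost N (Minus e f) = cost N e + cost N f + 1"
| "cost N (Arr e) = cost N e + 3"
| "cost N (Sum x y e) = N * (cost N e + 6) + 8"

definition represents :: "store \<Rightarrow> store \<Rightarrow> store \<Rightarrow> bool" where
  "represents R v a \<longleftrightarrow> (\<forall>x<20. R x = v x) \<and> (\<forall>j. R (100 + j) = a j)"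

lemma fits_less: "fits d e \<Longrightarrow> d < 100"
  by (induction e arbitrary: d) fastforce+

lemma exec_straight:
  "\<not> is_jump i \<Longrightarrow> R' = snd (exec_instr w i (0, R)) \<Longrightarrow> exec w (Ins i) R 1 R'"
  using exec_Ins by simp

lemma exec_seqI:
  "exec w c R t R' \<Longrightarrow> exec w d R' t' R'' \<Longrightarrow> s = t + t' \<Longrightarrow> exec w (c ;; d) R s R''"
  using exec_Seq by simp

text \<open>The body is an arbitrary code \<open>c\<close> that computes the summand, which keeps
  this induction on the number \<open>n - k\<close> of remaining rounds apart from the structural
  induction on expressions. \<open>R0\<close> fixes the contents to be preserved, as
  \<open>R\<close> changes from round to round.\<close>

lemma exec_sum_loop:
  fixes f :: "nat \<Rightarrow> nat"
  assumes body: "\<And>R k. k < n \<Longrightarrow> (\<forall>r. r < d \<and> r \<noteq> x \<or> 100 \<le> r \<longrightarrow> R r = R0 r) \<Longrightarrow> R x = k \<Longrightarrow>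
      \<exists>t R'. exec w c R t R' \<and> t \<le> T \<and> R' (d + 3) = f k \<and>
        (\<forall>r. r < d + 3 \<or> 100 \<le> r \<longrightarrow> R' r = R r)"
    and "x < d" "d + 3 < 100"
    and "k \<le> n" "\<forall>r. r < d \<and> r \<noteq> x \<or> 100 \<le> r \<longrightarrow> R r = R0 r" "R x = k"
    and "R d = (\<Sum>j<k. f j)" "R (d + 1) = s" "R (d + 2) = n"
  shows "\<exists>t R'. exec w (Loop (Ins (Sub (d + 3) (d + 2) x)) (d + 3)
       (c ;; Ins (Add d d (d + 3)) ;; Ins (Const (d + 3) 1) ;; Ins (Add x x (d + 3)))) R t R' \<and>
     t \<le> (n - k) * (T + 6) + 2 \<and> (\<forall>r. r < d \<and> r \<noteq> x \<or> 100 \<le> r \<longrightarrow> R' r = R0 r) \<and>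
     R' d = (\<Sum>j<n. f j) \<and> R' (d + 1) = s" (is "\<exists>t R'. exec w ?L R t R' \<and> _")
  using assms(4-)
proof (induction "n - k" arbitrary: k R)
  case 0
  let ?R = "R(d + 3 := 0)"
  have L: "exec w ?L R (1 + 1) ?R"
    using 0 by (intro exec_Loop_exit exec_straight) auto
  show ?case
    by (intro exI conjI, rule L) (use 0 assms(2,3) in auto)
next
  case (Suc m)
  let ?R = "R(d + 3 := n - k)"
  have R: "\<forall>r. r < d \<and> r \<noteq> x \<or> 100 \<le> r \<longrightarrow> ?R r = R0 r" "?R x = k"
    using Suc.prems assms(2,3) by auto
  have k: "k < n" using Suc.hyps(2) by simp
  obtain t R1 where t: "exec w c ?R t R1" "t \<le> T" "R1 (d + 3) = f k"
      "\<forall>r. r < d + 3 \<or> 100 \<le> r \<longrightarrow> R1 r = ?R r"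
    using body[OF k R] by blast
  let ?R2 = "R1(d := R1 d + R1 (d + 3), d + 3 := 1, x := k + 1)"
  have b: "exec w (c ;; Ins (Add d d (d + 3)) ;; Ins (Const (d + 3) 1) ;; Ins (Add x x (d + 3)))
      ?R (t + (1 + (1 + 1))) ?R2"
    using t R(2) assms(2,3)
    by (intro exec_Seq[OF t(1)] exec_Seq[OF exec_straight[where R' = "R1(d := R1 d + R1 (d + 3))"]]
        exec_Seq[OF exec_straight[where R' = "R1(d := R1 d + R1 (d + 3), d + 3 := 1)"]]
        exec_straight) auto
  have "\<exists>t R'. exec w ?L ?R2 t R' \<and>
     t \<le> (n - (k + 1)) * (T + 6) + 2 \<and> (\<forall>r. r < d \<and> r \<noteq> x \<or> 100 \<le> r \<longrightarrow> R' r = R0 r) \<and>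
     R' d = (\<Sum>j<n. f j) \<and> R' (d + 1) = s"
    using Suc.hyps(2) Suc.prems t assms(2,3) by (intro Suc.hyps(1)) auto
  then obtain t' R' where t': "exec w ?L ?R2 t' R'" "t' \<le> (n - (k + 1)) * (T + 6) + 2"
    "\<forall>r. r < d \<and> r \<noteq> x \<or> 100 \<le> r \<longrightarrow> R' r = R0 r" "R' d = (\<Sum>j<n. f j)" "R' (d + 1) = s"
    by blast
  have "exec w ?L R (1 + (t + (1 + (1 + 1))) + t' + 2) R'"
    using Suc.prems Suc.hyps(2) assms(2,3)
    by (intro exec_Loop_step[OF exec_straight _ b t'(1)]) auto
  moreover have "1 + (t + (1 + (1 + 1))) + t' + 2 \<le> (n - k) * (T + 6) + 2"
  proof -
    have "n - k = Suc (n - (k + 1))" using Suc.hyps(2) by simp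
    then show ?thesis using t(2) t'(2) by simp
  qed
  ultimately show ?case
    using t' by blast
qed

text \<open>The registers below \<open>d\<close> must survive: this protects the value of a first
  operand while the second is evaluated at \<open>d + 1\<close>, and it leaves all variables
  unchanged.\<close>

lemma exec_expr_code:
  assumes "represents R v a" "fits d e" "20 \<le> d" "\<forall>y\<in>bound_vars e. v y \<le> N"
  shows "\<exists>t R'. exec w (expr_code d e) R t R' \<and> t \<le> cost N e \<and> R' d = val v a e \<and>
     (\<forall>r. r < d \<or> 100 \<le> r \<longrightarrow> R' r = R r)"
  using assms
proof (induction e arbitrary: R v d)
  case (Num k)
  have X: "exec w (expr_code d (Num k)) R 1 (R(d := k))"
    unfolding expr_code.simps by (rule exec_straight) auto
  show ?case
    by (intro exI conjI, rule X) (use Num in auto)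
next
  case (Var x)
  have X: "exec w (expr_code d (Var x)) R 2 (R(d := R x))"
    unfolding expr_code.simps using Var
    by (intro exec_seqI[OF exec_straight[where R' = "R(d := 0)"] exec_straight]) auto
  show ?case
    by (intro exI conjI, rule X) (use Var in \<open>auto simp: represents_def\<close>)
next
  case (Plus e f)
  obtain t R1 where 1: "exec w (expr_code d e) R t R1" "t \<le> cost N e" "R1 d = val v a e"
     "\<forall>r. r < d \<or> 100 \<le> r \<longrightarrow> R1 r = R r"
    using Plus.IH(1)[of R v d] Plus.prems by auto
  have "represents R1 v a"
    using 1 Plus.prems by (auto simp: represents_def)
  then obtain t' R2 where 2: "exec w (expr_code (d + 1) f) R1 t' R2" "t' \<le> cost N f"
     "R2 (d + 1) = val v a f" "\<forall>r. r < d + 1 \<or> 100 \<le> r \<longrightarrow> R2 r = R1 r"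
    using Plus.IH(2)[of R1 v "d + 1"] Plus.prems by auto
  have X: "exec w (expr_code d (Plus e f)) R (t + (t' + 1)) (R2(d := val v a e + val v a f))"
    unfolding expr_code.simps
    by (intro exec_Seq[OF 1(1)] exec_Seq[OF 2(1)] exec_straight) (use 1 2 in simp_all)
  show ?case
    by (intro exI conjI, rule X) (use 1 2 fits_less[of d e] Plus.prems in auto)
next
  case (Minus e f)
  obtain t R1 where 1: "exec w (expr_code d e) R t R1" "t \<le> cost N e" "R1 d = val v a e"
     "\<forall>r. r < d \<or> 100 \<le> r \<longrightarrow> R1 r = R r"
    using Minus.IH(1)[of R v d] Minus.prems by auto
  have "represents R1 v a"
    using 1 Minus.prems by (auto simp: represents_def)
  then obtain t' R2 where 2: "exec w (expr_code (d + 1) f) R1 t' R2" "t' \<le> cost N f"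
     "R2 (d + 1) = val v a f" "\<forall>r. r < d + 1 \<or> 100 \<le> r \<longrightarrow> R2 r = R1 r"
    using Minus.IH(2)[of R1 v "d + 1"] Minus.prems by auto
  have X: "exec w (expr_code d (Minus e f)) R (t + (t' + 1)) (R2(d := val v a e - val v a f))"
    unfolding expr_code.simps
    by (intro exec_Seq[OF 1(1)] exec_Seq[OF 2(1)] exec_straight) (use 1 2 in simp_all)
  show ?case
    by (intro exI conjI, rule X) (use 1 2 fits_less[of d e] Minus.prems in auto)
next
  case (Arr e)
  obtain t R1 where 1: "exec w (expr_code d e) R t R1" "t \<le> cost N e" "R1 d = val v a e"
     "\<forall>r. r < d \<or> 100 \<le> r \<longrightarrow> R1 r = R r"
    using Arr.IH[of R v d] Arr.prems by auto
  let ?R = "R1(d + 1 := 100, d := a (val v a e))"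
  have array: "R1 (100 + val v a e) = a (val v a e)"
    using 1(4) Arr.prems by (auto simp: represents_def)
  have X: "exec w (expr_code d (Arr e)) R (t + (1 + (1 + 1))) ?R"
    unfolding expr_code.simps
    by (rule exec_Seq[OF 1(1) exec_Seq[OF exec_straight[where R' = "R1(d + 1 := 100)"]
          exec_Seq[OF exec_straight[where R' = "R1(d + 1 := 100, d := 100 + val v a e)"]
            exec_straight]]]) (use 1 array fits_less[of d e] Arr.prems in \<open>simp_all add: add.commute\<close>)
  show ?case
    by (intro exI conjI, rule X) (use 1 Arr.prems in auto)
next
  case (Sum x y e)
  let ?R = "R(d := 0, d + 1 := R x, d + 2 := R y, x := 0)"
  have d: "d + 3 < 100" "x < d" "y < d"
    using Sum.prems fits_less[of "d + 3" e] by auto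
  let ?L = "Loop (Ins (Sub (d + 3) (d + 2) x)) (d + 3)
       (expr_code (d + 3) e ;; Ins (Add d d (d + 3)) ;; Ins (Const (d + 3) 1) ;;
        Ins (Add x x (d + 3)))"
  have loop: "\<exists>t R'. exec w ?L ?R t R' \<and>
     t \<le> (v y - 0) * (cost N e + 6) + 2 \<and> (\<forall>r. r < d \<and> r \<noteq> x \<or> 100 \<le> r \<longrightarrow> R' r = R r) \<and>
     R' d = (\<Sum>k<v y. val (v(x := k)) a e) \<and> R' (d + 1) = R x"
  proof (rule exec_sum_loop[where k = 0])
    fix R2 k
    assume k: "k < v y" "\<forall>r. r < d \<and> r \<noteq> x \<or> 100 \<le> r \<longrightarrow> R2 r = R r" "R2 x = k"
    have rep: "represents R2 (v(x := k)) a"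
      using k Sum.prems by (auto simp: represents_def)
    have bnd: "\<forall>z\<in>bound_vars e. (v(x := k)) z \<le> N"
      using k Sum.prems by auto
    show "\<exists>t R'. exec w (expr_code (d + 3) e) R2 t R' \<and> t \<le> cost N e \<and>
        R' (d + 3) = val (v(x := k)) a e \<and> (\<forall>r. r < d + 3 \<or> 100 \<le> r \<longrightarrow> R' r = R2 r)"
      by (rule Sum.IH[OF rep _ _ bnd]) (use Sum.prems in auto)
  qed (use d Sum.prems in \<open>auto simp: represents_def\<close>)
  then obtain t R1 where t: "exec w ?L ?R t R1"
     "t \<le> v y * (cost N e + 6) + 2" "\<forall>r. r < d \<and> r \<noteq> x \<or> 100 \<le> r \<longrightarrow> R1 r = R r"
     "R1 d = (\<Sum>k<v y. val (v(x := k)) a e)" "R1 (d + 1) = R x"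
    by auto
  let ?R' = "R1(d + 3 := 0, x := R x)"
  have X: "exec w (expr_code d (Sum x y e)) R (1 + (1 + (1 + (1 + (t + (1 + 1)))))) ?R'"
    unfolding expr_code.simps
    by (rule exec_Seq[OF exec_straight[where R' = "R(d := 0)"]
        exec_Seq[OF exec_straight[where R' = "R(d := 0, d + 1 := R x)"]
        exec_Seq[OF exec_straight[where R' = "R(d := 0, d + 1 := R x, d + 2 := R y)"]
        exec_Seq[OF exec_straight[where R' = ?R] exec_Seq[OF t(1)
        exec_Seq[OF exec_straight[where R' = "R1(d + 3 := 0)"] exec_straight]]]]]])
      (use d t(5) in simp_all)
  have t': "1 + (1 + (1 + (1 + (t + (1 + 1))))) \<le> cost N (Sum x y e)"
  proof -
    have "v y * (cost N e + 6) \<le> N * (cost N e + 6)"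
      using Sum.prems by (intro mult_le_mono1) auto
    then show ?thesis using t(2) unfolding cost.simps by linarith
  qed
  show ?case
    by (intro exI conjI, rule X, rule t') (use t d in auto)
qed


section \<open>Timed Hoare triples\<close>

text \<open>Total correctness with a time bound. Assertions see only variables and the array;
  \<open>represents\<close> hides the scratch registers.\<close>

definition triple ::
  "bool list \<Rightarrow> (store \<Rightarrow> store \<Rightarrow> bool) \<Rightarrow> code \<Rightarrow> nat \<Rightarrow> (store \<Rightarrow> store \<Rightarrow> bool) \<Rightarrow> bool" where
  "triple w P c T Q \<longleftrightarrow> (\<forall>R v a. represents R v a \<and> P v a \<longrightarrow>
     (\<exists>t R' v' a'. exec w c R t R' \<and> t \<le> T \<and> represents R' v' a' \<and> Q v' a'))"

lemma tripleI:
  assumes "\<And>R v a. represents R v a \<Longrightarrow> P v a \<Longrightarrow>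
     \<exists>t R' v' a'. exec w c R t R' \<and> t \<le> T \<and> represents R' v' a' \<and> Q v' a'"
  shows "triple w P c T Q"
  using assms by (auto simp: triple_def)

lemma tripleE:
  assumes "triple w P c T Q" "represents R v a" "P v a"
  obtains t R' v' a' where "exec w c R t R'" "t \<le> T" "represents R' v' a'" "Q v' a'"
  using assms unfolding triple_def by blast

lemma triple_weaken:
  assumes "triple w P' c T' Q'" "\<And>v a. P v a \<Longrightarrow> P' v a" "T' \<le> T" "\<And>v a. Q' v a \<Longrightarrow> Q v a"
  shows "triple w P c T Q"
proof (rule tripleI)
  fix R v a assume R: "represents R v a" "P v a"
  obtain t R' v' a' where "exec w c R t R'" "t \<le> T'" "represents R' v' a'" "Q' v' a'"
    by (rule tripleE[OF assms(1), OF R(1) assms(2)[OF R(2)]])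
  then show "\<exists>t R' v' a'. exec w c R t R' \<and> t \<le> T \<and> represents R' v' a' \<and> Q v' a'"
    using assms(3,4) order_trans by blast
qed

lemma triple_pre:
  assumes "triple w P' c T Q" "\<And>v a. P v a \<Longrightarrow> P' v a"
  shows "triple w P c T Q"
  by (rule triple_weaken[OF assms(1)]) (use assms(2) in auto)

lemma triple_seq:
  assumes "triple w P c T P'" "triple w P' d T' Q"
  shows "triple w P (c ;; d) (T + T') Q"
proof (rule tripleI)
  fix R v a assume R: "represents R v a" "P v a"
  obtain t R1 v1 a1 where 1: "exec w c R t R1" "t \<le> T" "represents R1 v1 a1" "P' v1 a1"
    by (rule tripleE[OF assms(1), OF R])
  obtain t' R2 v2 a2 where 2: "exec w d R1 t' R2" "t' \<le> T'" "represents R2 v2 a2" "Q v2 a2"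
    by (rule tripleE[OF assms(2), OF 1(3,4)])
  show "\<exists>t R' v' a'. exec w (c ;; d) R t R' \<and> t \<le> T + T' \<and> represents R' v' a' \<and> Q v' a'"
    by (intro exI conjI, rule exec_Seq[OF 1(1) 2(1)], use 1(2) 2(2) in simp, rule 2(3), rule 2(4))
qed

lemma exec_expr_codeE:
  assumes "represents R v a" "fits 20 e" "\<forall>y\<in>bound_vars e. v y \<le> N"
  obtains t R' where "exec w (expr_code 20 e) R t R'" "t \<le> cost N e" "R' 20 = val v a e"
    "represents R' v a"
proof -
  obtain t R' where R': "exec w (expr_code 20 e) R t R'" "t \<le> cost N e" "R' 20 = val v a e"
     "\<forall>r. r < 20 \<or> 100 \<le> r \<longrightarrow> R' r = R r"
    using exec_expr_code[OF assms(1,2) _ assms(3)] by blast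
  then have "represents R' v a"
    using assms(1) by (auto simp: represents_def)
  with R' that show thesis by blast
qed

section \<open>Commands and their proof rules\<close>

definition skip :: code where
  "skip = Ins (Const 20 0)"

definition assign :: "nat \<Rightarrow> expr \<Rightarrow> code" where
  "assign x e = expr_code 20 e ;; Ins (Const 21 0) ;; Ins (Add x 20 21)"

definition store :: "expr \<Rightarrow> expr \<Rightarrow> code" where
  "store e f = expr_code 20 e ;; expr_code 21 f ;; Ins (Const 22 100) ;; Ins (Add 20 20 22) ;;
     Ins (Store 20 21)"

definition input :: "nat \<Rightarrow> nat \<Rightarrow> code" where
  "input x y = Ins (Read x y)"

definition ite :: "expr \<Rightarrow> code \<Rightarrow> code \<Rightarrow> code" where
  "ite e c d = expr_code 20 e ;; Cond 20 c d"

definition while :: "expr \<Rightarrow> code \<Rightarrow> code" where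
  "while e c = Loop (expr_code 20 e) 20 c"

lemma triple_skip: "triple w Q skip 1 Q"
proof (rule tripleI)
  fix R v a assume R: "represents R v a" "Q v a"
  have X: "exec w skip R 1 (R(20 := 0))"
    unfolding skip_def by (rule exec_straight) auto
  have r: "represents (R(20 := 0)) v a"
    using R(1) by (simp add: represents_def)
  show "\<exists>t R' v' a'. exec w skip R t R' \<and> t \<le> 1 \<and> represents R' v' a' \<and> Q v' a'"
    by (intro exI conjI, rule X, simp, rule r, rule R(2))
qed

text \<open>A backward rule for arbitrary \<open>Q\<close>, so that straight-line code is verified
  by composing rules and checking a single implication. The bound on the limits belongs to the
  precondition because it depends on the store.\<close>

lemma triple_assign:
  assumes "fits 20 e" "x < 20"
  shows "triple w (\<lambda>v a. (\<forall>y\<in>bound_vars e. v y \<le> N) \<and> Q (v(x := val v a e)) a)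
    (assign x e) (cost N e + 2) Q"
proof (rule tripleI, elim conjE)
  fix R v a assume R: "represents R v a" "\<forall>y\<in>bound_vars e. v y \<le> N" "Q (v(x := val v a e)) a"
  obtain t R1 where 1: "exec w (expr_code 20 e) R t R1" "t \<le> cost N e" "R1 20 = val v a e"
    "represents R1 v a"
    using exec_expr_codeE[OF R(1) assms(1) R(2)] by blast
  have X: "exec w (assign x e) R (t + (1 + 1)) (R1(21 := 0, x := val v a e))"
    unfolding assign_def
    by (rule exec_Seq[OF 1(1) exec_Seq[OF exec_straight[where R' = "R1(21 := 0)"] exec_straight]])
      (simp_all add: 1)
  have r: "represents (R1(21 := 0, x := val v a e)) (v(x := val v a e)) a"
    using 1(4) assms by (auto simp: represents_def)
  show "\<exists>t R' v' a'. exec w (assign x e) R t R' \<and> t \<le> cost N e + 2 \<and> represents R' v' a' \<and> Q v' a'"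
    by (intro exI conjI, rule X, use 1(2) in simp, rule r, rule R(3))
qed

lemma triple_store:
  assumes "fits 20 e" "fits 21 f"
  shows "triple w (\<lambda>v a. (\<forall>y\<in>bound_vars e \<union> bound_vars f. v y \<le> N) \<and>
      Q v (a(val v a e := val v a f))) (store e f) (cost N e + cost N f + 3) Q"
proof (rule tripleI, elim conjE)
  fix R v a assume R: "represents R v a" "\<forall>y\<in>bound_vars e \<union> bound_vars f. v y \<le> N"
    "Q v (a(val v a e := val v a f))"
  obtain t R1 where 1: "exec w (expr_code 20 e) R t R1" "t \<le> cost N e" "R1 20 = val v a e"
    "represents R1 v a"
    using exec_expr_codeE[OF R(1) assms(1), of N w] R(2) by blast
  obtain t' R2 where 2: "exec w (expr_code 21 f) R1 t' R2" "t' \<le> cost N f" "R2 21 = val v a f"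
    "\<forall>r. r < 21 \<or> 100 \<le> r \<longrightarrow> R2 r = R1 r"
    using exec_expr_code[OF 1(4) assms(2), of N w] R(2) by auto
  let ?R = "R2(22 := 100, 20 := 100 + val v a e, 100 + val v a e := val v a f)"
  have X: "exec w (store e f) R (t + (t' + (1 + (1 + 1)))) ?R"
    unfolding store_def
    by (rule exec_Seq[OF 1(1) exec_Seq[OF 2(1) exec_Seq[OF exec_straight[where R' = "R2(22 := 100)"]
        exec_Seq[OF exec_straight[where R' = "R2(22 := 100, 20 := 100 + val v a e)"] exec_straight]]]])
      (use 1 2 in \<open>simp_all add: add.commute\<close>)
  have r: "represents ?R v (a(val v a e := val v a f))"
    using 1(4) 2(4) by (auto simp: represents_def)
  show "\<exists>t R' v' a'. exec w (store e f) R t R' \<and> t \<le> cost N e + cost N f + 3 \<and>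
      represents R' v' a' \<and> Q v' a'"
    by (intro exI conjI, rule X, use 1(2) 2(2) in simp, rule r, rule R(3))
qed

lemma triple_input:
  assumes "x < 20" "y < 20"
  shows "triple w (\<lambda>v a. Q (v(x := input_symbol w (v y))) a) (input x y) 1 Q"
proof (rule tripleI)
  fix R v a assume R: "represents R v a" "Q (v(x := input_symbol w (v y))) a"
  have X: "exec w (input x y) R 1 (R(x := input_symbol w (v y)))"
    unfolding input_def
    by (rule exec_straight) (use R(1) assms in \<open>auto simp: represents_def\<close>)
  have r: "represents (R(x := input_symbol w (v y))) (v(x := input_symbol w (v y))) a"
    using R(1) assms by (auto simp: represents_def)
  show "\<exists>t R' v' a'. exec w (input x y) R t R' \<and> t \<le> 1 \<and> represents R' v' a' \<and> Q v' a'"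
    by (intro exI conjI, rule X, simp, rule r, rule R(2))
qed

lemma triple_ite:
  assumes "fits 20 e" "\<And>v a. P v a \<Longrightarrow> \<forall>y\<in>bound_vars e. v y \<le> N"
    "triple w (\<lambda>v a. P v a \<and> val v a e \<noteq> 0) c T Q"
    "triple w (\<lambda>v a. P v a \<and> val v a e = 0) d T' Q"
  shows "triple w P (ite e c d) (cost N e + max T T' + 2) Q"
proof (rule tripleI)
  fix R v a assume R: "represents R v a" "P v a"
  obtain t R1 where 1: "exec w (expr_code 20 e) R t R1" "t \<le> cost N e" "R1 20 = val v a e"
    "represents R1 v a"
    using exec_expr_codeE[OF R(1) assms(1) assms(2)[OF R(2)]] by blast
  show "\<exists>t R' v' a'. exec w (ite e c d) R t R' \<and> t \<le> cost N e + max T T' + 2 \<and>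
      represents R' v' a' \<and> Q v' a'"
  proof (cases "val v a e = 0")
    case True
    obtain t' R2 v2 a2 where 2: "exec w d R1 t' R2" "t' \<le> T'" "represents R2 v2 a2" "Q v2 a2"
      by (rule tripleE[OF assms(4), OF 1(4)]) (use True R in auto)
    have X: "exec w (ite e c d) R (t + (t' + 1)) R2"
      unfolding ite_def by (rule exec_Seq[OF 1(1) exec_Cond_false[OF _ 2(1)]]) (use True 1 in simp)
    show ?thesis
      by (intro exI conjI, rule X, use 1(2) 2(2) in simp, rule 2(3), rule 2(4))
  next
    case False
    obtain t' R2 v2 a2 where 2: "exec w c R1 t' R2" "t' \<le> T" "represents R2 v2 a2" "Q v2 a2"
      by (rule tripleE[OF assms(3), OF 1(4)]) (use False R in auto)
    have X: "exec w (ite e c d) R (t + (t' + 2)) R2"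
      unfolding ite_def by (rule exec_Seq[OF 1(1) exec_Cond_true[OF _ 2(1)]]) (use False 1 in simp)
    show ?thesis
      by (intro exI conjI, rule X, use 1(2) 2(2) in simp, rule 2(3), rule 2(4))
  qed
qed

text \<open>The measure \<open>\<mu>\<close> strictly decreases, so there are at most
  \<open>K\<close> rounds, each paying guard, body and two control steps; the last guard and the
  exit add \<open>cost N e + 1\<close>.\<close>

lemma triple_while:
  assumes fits: "fits 20 e" and bnd: "\<And>v a. I v a \<Longrightarrow> \<forall>y\<in>bound_vars e. v y \<le> N"
    and body: "\<And>k. triple w (\<lambda>v a. I v a \<and> val v a e \<noteq> 0 \<and> \<mu> v a = k) c T
      (\<lambda>v a. I v a \<and> \<mu> v a < k)"
  shows "triple w (\<lambda>v a. I v a \<and> \<mu> v a \<le> K) (while e c) (K * (cost N e + T + 2) + cost N e + 1)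
    (\<lambda>v a. I v a \<and> val v a e = 0)"
proof (rule tripleI, elim conjE)
  fix R v a assume "represents R v a" "I v a" "\<mu> v a \<le> K"
  then show "\<exists>t R' v' a'. exec w (while e c) R t R' \<and> t \<le> K * (cost N e + T + 2) + cost N e + 1 \<and>
      represents R' v' a' \<and> I v' a' \<and> val v' a' e = 0"
  proof (induction K arbitrary: R v a rule: less_induct)
    case (less K)
    obtain t R1 where 1: "exec w (expr_code 20 e) R t R1" "t \<le> cost N e" "R1 20 = val v a e"
      "represents R1 v a"
      using exec_expr_codeE[OF less.prems(1) fits bnd[OF less.prems(2)]] by blast
    show ?case
    proof (cases "val v a e = 0")
      case True
      have X: "exec w (while e c) R (t + 1) R1"
        unfolding while_def by (rule exec_Loop_exit[OF 1(1)]) (use True 1 in simp)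
      show ?thesis
        by (intro exI conjI, rule X, use 1(2) in simp, rule 1(4), rule less.prems(2), rule True)
    next
      case False
      obtain t' R2 v2 a2 where 2: "exec w c R1 t' R2" "t' \<le> T" "represents R2 v2 a2" "I v2 a2"
          "\<mu> v2 a2 < \<mu> v a"
        by (rule tripleE[OF body[of "\<mu> v a"], OF 1(4)]) (use False less.prems in auto)
      have K: "K - 1 < K" "\<mu> v2 a2 \<le> K - 1"
        using 2(5) less.prems by auto
      obtain t'' R3 v3 a3 where 3: "exec w (while e c) R2 t'' R3"
          "t'' \<le> (K - 1) * (cost N e + T + 2) + cost N e + 1"
          "represents R3 v3 a3" "I v3 a3" "val v3 a3 e = 0"
        using less.IH[OF K(1) 2(3,4) K(2)] by blast
      have X: "exec w (while e c) R (t + t' + t'' + 2) R3"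
        unfolding while_def
        by (rule exec_Loop_step[OF 1(1) _ 2(1) 3(1)[unfolded while_def]]) (use False 1 in simp)
      have "K * (cost N e + T + 2) = (K - 1) * (cost N e + T + 2) + (cost N e + T + 2)"
        using K(1) by (cases K) auto
      then have t: "t + t' + t'' + 2 \<le> K * (cost N e + T + 2) + cost N e + 1"
        using 1(2) 2(2) 3(2) by linarith
      show ?thesis
        by (intro exI conjI, rule X, rule t, rule 3(3), rule 3(4), rule 3(5))
    qed
  qed
qed

text \<open>The initial registers represent the store and the array that are 0 everywhere, and the
  output register is variable 0.\<close>

lemma outputs_within_triple:
  assumes "triple w (\<lambda>v a. v = (\<lambda>_. 0) \<and> a = (\<lambda>_. 0)) c T (\<lambda>v a. v 0 = k)" "T \<le> t"
  shows "outputs_within (assemble 0 c) w t k"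
proof -
  have "represents (\<lambda>_. 0) (\<lambda>_. 0) (\<lambda>_. 0)" by (simp add: represents_def)
  then obtain s R v a where "exec w c (\<lambda>_. 0) s R" "s \<le> T" "represents R v a" "v 0 = k"
    using tripleE[OF assms(1)] by (metis (no_types, lifting))
  then show ?thesis
    using outputs_within_assemble[of w c s R t] assms(2) by (auto simp: represents_def)
qed


section \<open>Polynomial bounds\<close>

definition poly_bounded :: "(nat \<Rightarrow> nat) \<Rightarrow> bool" where
  "poly_bounded f \<longleftrightarrow> (\<exists>p :: nat poly. \<forall>N. f N \<le> poly p N)"

lemma poly_bounded_const: "poly_bounded (\<lambda>N. k)"
  unfolding poly_bounded_def by (rule exI[of _ "[:k:]"]) simp

lemma poly_bounded_id: "poly_bounded (\<lambda>N. N)"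
  unfolding poly_bounded_def by (rule exI[of _ "[:0, 1:]"]) simp

lemma poly_bounded_add:
  assumes "poly_bounded f" "poly_bounded g"
  shows "poly_bounded (\<lambda>N. f N + g N)"
  using assms unfolding poly_bounded_def by (metis add_mono poly_add)

lemma poly_bounded_mult:
  assumes "poly_bounded f" "poly_bounded g"
  shows "poly_bounded (\<lambda>N. f N * g N)"
  using assms unfolding poly_bounded_def by (metis mult_le_mono poly_mult)

text \<open>The expression is fixed, so \<open>N\<close> enters only as one factor per level of
  nested sums.\<close>

lemma poly_bounded_cost: "poly_bounded (\<lambda>N. cost N e)"
  by (induction e)
    (auto simp only: cost.simps intro!: poly_bounded_const poly_bounded_id poly_bounded_add poly_bounded_mult)

lemmas poly_bounded_intros =
  poly_bounded_const poly_bounded_id poly_bounded_add poly_bounded_mult poly_bounded_cost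


section \<open>Codes of instances\<close>

text \<open>Padding with 0 matches the initial registers, so the array after parsing equals
  \<open>tab cs\<close> everywhere.\<close>

definition tab :: "nat list \<Rightarrow> store" where
  "tab cs j = (if j < length cs then cs ! j else 0)"

lemma tab_eq_iff: "length cs = length ds \<Longrightarrow> cs = ds \<longleftrightarrow> (\<forall>j<length cs. tab cs j = tab ds j)"
  by (auto simp: tab_def list_eq_iff_nth_eq)

lemma length_concat_upt:
  "length (concat (map (\<lambda>i. map (F i) [0..<n]) [0..<m])) = m * n"
  by (simp add: length_concat comp_def sum_list_triv)

lemma nth_concat_upt:
  assumes "i < m" "x < (n::nat)"
  shows "concat (map (\<lambda>i. map (F i) [0..<n]) [0..<m]) ! (i * n + x) = F i x"
  using assms
proof (induction m)
  case (Suc m)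
  show ?case
  proof (cases "i < m")
    case True
    then have "i * n + x < m * n"
      using Suc.prems by (metis add.commute add_less_cancel_right less_le_trans mult_Suc mult_le_mono1 Suc_leI)
    with True Suc show ?thesis by (simp add: nth_append length_concat_upt)
  next
    case False
    with Suc.prems have "i = m" by simp
    with Suc.prems show ?thesis by (simp add: nth_append length_concat_upt)
  qed
qed simp

lemma mult_add_less:
  assumes "i < m" "x < (n::nat)"
  shows "i * n + x < m * n"
proof -
  have "i * n + x < Suc i * n" using assms(2) by simp
  also have "\<dots> \<le> m * n" using assms(1) by (intro mult_le_mono1) simp
  finally show ?thesis .
qed

lemma length_erhf_code:
  "length (erhf_code E) = 2 + num_edges E * num_vertices E + num_vertices E + num_vertices E"
  unfolding erhf_code_def by (simp add: length_concat_upt)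

lemma tab_erhf_code:
  shows "tab (erhf_code E) 0 = num_vertices E"
    and "tab (erhf_code E) 1 = num_edges E"
    and "i < num_edges E \<Longrightarrow> x < num_vertices E \<Longrightarrow>
      tab (erhf_code E) (2 + i * num_vertices E + x) = of_bool (x \<in> edge_sets E i)"
    and "x < num_vertices E \<Longrightarrow>
      tab (erhf_code E) (2 + num_edges E * num_vertices E + x) = corr E x"
    and "x < num_vertices E \<Longrightarrow>
      tab (erhf_code E) (2 + num_edges E * num_vertices E + num_vertices E + x) = base_fun E x"
proof -
  show "tab (erhf_code E) 0 = num_vertices E" "tab (erhf_code E) 1 = num_edges E"
    by (simp_all add: tab_def erhf_code_def)
  show "tab (erhf_code E) (2 + i * num_vertices E + x) = of_bool (x \<in> edge_sets E i)"
    if "i < num_edges E" "x < num_vertices E"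
    using mult_add_less[OF that] that
    by (simp add: tab_def length_erhf_code) (simp add: erhf_code_def nth_append length_concat_upt nth_concat_upt)
  show "tab (erhf_code E) (2 + num_edges E * num_vertices E + x) = corr E x"
    "tab (erhf_code E) (2 + num_edges E * num_vertices E + num_vertices E + x) = base_fun E x"
    if "x < num_vertices E"
    using that
    by (simp_all add: tab_def length_erhf_code) (simp_all add: erhf_code_def nth_append length_concat_upt)
qed

text \<open>Phrased on the padded table so that an expression can test it. Searching for
  \<open>i\<close> instead of indexing by the table entry keeps the row number in a variable, which
  a limit of a sum has to be.\<close>

definition valid_code :: "nat list \<Rightarrow> bool" where
  "valid_code cs \<longleftrightarrow> (let A = tab cs; n = A 0; m = A 1 in
     2 \<le> length cs \<and> length cs = 2 + m * n + n + n \<and>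
     (\<forall>i<m. \<forall>x<n. A (2 + i * n + x) \<le> 1) \<and>
     (\<forall>x<n. (\<exists>i<m. A (2 + m * n + x) = i \<and> A (2 + i * n + x) \<noteq> 0) \<and> A (2 + m * n + n + x) \<le> 2))"

lemma valid_code_erhf_code:
  assumes "E \<in> erhf_instances"
  shows "valid_code (erhf_code E)"
proof -
  have "corr E x < num_edges E" "x \<in> edge_sets E (corr E x)" "base_fun E x \<in> {0, 1, 2}"
    if "x < num_vertices E" for x
    using assms that by (auto simp: erhf_instances_def correspondence_def verts_def edges_def PiE_iff)
  moreover from this(3) have "base_fun E x \<le> 2" if "x < num_vertices E" for x
    using that by fastforce
  ultimately show ?thesis
    by (auto simp: valid_code_def Let_def tab_erhf_code[unfolded One_nat_def] length_erhf_code simp del: add_2_eq_Suc)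
qed

text \<open>The functions are restricted because \<open>erhf_instances\<close> demands extensional
  ones.\<close>

definition decode_code :: "nat list \<Rightarrow> erhf_instance" where
  "decode_code cs = (let A = tab cs; n = A 0; m = A 1 in
     \<lparr>num_vertices = n, num_edges = m,
      edge_sets = (\<lambda>i\<in>{..<m}. {x. x < n \<and> A (2 + i * n + x) \<noteq> 0}),
      corr = (\<lambda>x\<in>{..<n}. A (2 + m * n + x)),
      base_fun = (\<lambda>x\<in>{..<n}. A (2 + m * n + n + x))\<rparr>)"

text \<open>Together with \<open>valid_code_erhf_code\<close> this shows that the codes of instances
  are exactly the valid lists, so testing the table suffices to recognise encodings.\<close>

lemma decode_code:
  assumes "valid_code cs"
  shows "decode_code cs \<in> erhf_instances" "erhf_code (decode_code cs) = cs"
proof -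
  define A n m where "A = tab cs" "n = A 0" "m = A 1"
  have v: "2 \<le> length cs" "length cs = 2 + m * n + n + n"
     "\<forall>i<m. \<forall>x<n. A (2 + i * n + x) \<le> 1"
     "\<forall>x<n. (\<exists>i<m. A (2 + m * n + x) = i \<and> A (2 + i * n + x) \<noteq> 0) \<and> A (2 + m * n + n + x) \<le> 2"
    using assms unfolding valid_code_def Let_def A_n_m_def by blast+
  have D: "decode_code cs = \<lparr>num_vertices = n, num_edges = m,
      edge_sets = (\<lambda>i\<in>{..<m}. {x. x < n \<and> A (2 + i * n + x) \<noteq> 0}),
      corr = (\<lambda>x\<in>{..<n}. A (2 + m * n + x)),
      base_fun = (\<lambda>x\<in>{..<n}. A (2 + m * n + n + x))\<rparr>"
    unfolding decode_code_def Let_def A_n_m_def ..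
  let ?E = "decode_code cs"
  have "A (2 + m * n + n + x) \<in> {0, 1, 2}" if "x < n" for x
    using v(4) that by force
  then show "?E \<in> erhf_instances"
    using v(4) unfolding erhf_instances_def hypergraph_def correspondence_def verts_def edges_def D
    by (auto simp: PiE_iff simp del: add_2_eq_Suc)
  have num: "num_vertices ?E = n" "num_edges ?E = m"
    by (simp_all add: D)
  note T = tab_erhf_code[where E = ?E, unfolded num]
  have len: "length (erhf_code ?E) = length cs"
    by (simp add: length_erhf_code num v(2))
  have "tab (erhf_code ?E) j = A j" if j: "j < 2 + m * n + n + n" for j
  proof -
    consider "j = 0" | "j = 1" | "2 \<le> j" "j < 2 + m * n" |
      "2 + m * n \<le> j" "j < 2 + m * n + n" | "2 + m * n + n \<le> j"
      by linarith
    then show ?thesis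
    proof cases
      case 3
      define i x where "i = (j - 2) div n" "x = (j - 2) mod n"
      have "n > 0" using 3 by (cases n) auto
      then have ix: "i < m" "x < n" "j = 2 + i * n + x"
        using 3 by (auto simp: i_x_def less_mult_imp_div_less)
      \<comment> \<open>A matrix entry is at most 1, so it is determined by whether it is
        nonzero.\<close>
      then show ?thesis
        using T(3)[OF ix(1,2)] v(3)[rule_format, OF ix(1,2)] by (auto simp: D of_bool_def le_Suc_eq)
    next
      case 4
      then obtain x where x: "j = 2 + m * n + x" "x < n"
        by (auto simp: le_iff_add)
      then show ?thesis
        using T(4)[OF x(2)] by (simp add: D)
    next
      case 5
      then obtain x where x: "j = 2 + m * n + n + x" "x < n"
        using j by (auto simp: le_iff_add)
      then show ?thesis
        using T(5)[OF x(2)] by (simp add: D)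
    qed (use T(1,2) in \<open>simp_all add: A_n_m_def\<close>)
  qed
  then show "erhf_code ?E = cs"
    using tab_eq_iff[OF len] len v(2) by (simp add: A_n_m_def(1))
qed

text \<open>The parser ends with complete blocks and possibly a dangling block of ones. Complete
  blocks end in \<open>False\<close>, so in an encoding nothing dangles.\<close>

lemma concat_unary_replicate_inj:
  assumes "concat (map unary cs) = concat (map unary ds) @ replicate k True"
  shows "k = 0 \<and> cs = ds"
proof -
  have "k = 0"
  proof (rule ccontr)
    assume "k \<noteq> 0"
    then obtain l where l: "replicate k True = replicate l True @ [True]"
      by (cases k) (auto simp: replicate_append_same)
    then have "concat (map unary cs) \<noteq> []" using assms by auto
    then obtain bs c where "cs = bs @ [c]"
      by (cases cs rule: rev_cases) auto
    then show False using assms l by (auto simp: unary_def)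
  qed
  then show ?thesis using assms concat_unary_inj by auto
qed

lemma erhf_parameter_encode:
  "E \<in> erhf_instances \<Longrightarrow> erhf_parameter \<kappa> (erhf_encode E) = \<kappa> E"
  by (simp add: erhf_parameter_def inv_into_f_f[OF inj_on_erhf_encode])

lemma erhf_encode_in_language:
  "E \<in> erhf_instances \<Longrightarrow> erhf_encode E \<in> erhf_language \<longleftrightarrow> erhf_yes E"
  using inj_on_erhf_encode by (auto simp: erhf_language_def dest: inj_onD)

text \<open>This is what makes the input length an upper bound for the limits of all sums.\<close>

lemma entry_le_length_concat_unary: "c \<in> set cs \<Longrightarrow> c \<le> length (concat (map unary cs))"
  by (induction cs) (auto simp: unary_def)


section \<open>Roman hitting functions\<close>

lemma rhf_mono:
  assumes "hypergraph X I s" "correspondence X I s \<tau>"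
    "rhf X I s \<tau> h" "g \<in> X \<rightarrow>\<^sub>E {0, 1, 2}" "\<forall>x\<in>X. h x \<le> g x"
  shows "rhf X I s \<tau> g"
  unfolding rhf_def
proof (intro conjI ballI)
  fix i assume i: "i \<in> I"
  have sub: "s i \<subseteq> X" using assms(1) i by (auto simp: hypergraph_def)
  have g: "g x \<in> {0, 1, 2}" if "x \<in> X" for x by (rule PiE_mem[OF assms(4) that])
  consider x where "x \<in> s i" "h x = 2" | x where "x \<in> X" "\<tau> x = i" "h x = 1"
    using assms(3) i unfolding rhf_def by blast
  then show "(\<exists>x\<in>s i. g x = 2) \<or> (\<exists>x\<in>X. \<tau> x = i \<and> g x = 1)"
  proof cases
    case 1
    then have "2 \<le> g x" "g x \<in> {0, 1, 2}" using assms(5) g sub by fastforce+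
    with 1 show ?thesis by auto
  next
    case 2
    \<comment> \<open>A 1 may have been raised to 2; as \<open>x\<close> lies in
      \<open>s (\<tau> x)\<close>, the hyperedge is then hit by the first clause of
      \<open>rhf\<close>.\<close>
    then have "1 \<le> g x" "g x \<in> {0, 1, 2}" "x \<in> s i"
      using assms(2,5) g by (fastforce simp: correspondence_def)+
    with 2 show ?thesis by auto
  qed
qed (fact assms(4))

lemma minimal_rhf_iff:
  assumes "hypergraph X I s" "correspondence X I s \<tau>"
  shows "minimal_rhf X I s \<tau> g \<longleftrightarrow> rhf X I s \<tau> g \<and>
    (\<forall>z\<in>X. g z = 0 \<or> \<not> rhf X I s \<tau> (g(z := g z - 1)))"
proof (intro iffI conjI ballI)
  fix z assume min: "minimal_rhf X I s \<tau> g" and "z \<in> X"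
  show "g z = 0 \<or> \<not> rhf X I s \<tau> (g(z := g z - 1))"
  proof (rule disjCI)
    assume "\<not> \<not> rhf X I s \<tau> (g(z := g z - 1))"
    then have "g(z := g z - 1) = g"
      using min unfolding minimal_rhf_def by auto
    then have "g z - 1 = g z" by (metis fun_upd_same)
    then show "g z = 0" by simp
  qed
next
  assume *: "rhf X I s \<tau> g \<and> (\<forall>z\<in>X. g z = 0 \<or> \<not> rhf X I s \<tau> (g(z := g z - 1)))"
  then have g: "g \<in> X \<rightarrow>\<^sub>E {0, 1, 2}" by (simp add: rhf_def)
  show "minimal_rhf X I s \<tau> g"
    unfolding minimal_rhf_def
  proof (intro conjI allI impI)
    fix h assume h: "rhf X I s \<tau> h \<and> (\<forall>x\<in>X. h x \<le> g x)"
    then have hX: "h \<in> X \<rightarrow>\<^sub>E {0, 1, 2}" by (simp add: rhf_def)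
    show "h = g"
    proof (rule PiE_ext[OF hX g], rule ccontr)
      \<comment> \<open>If \<open>h\<close> is below \<open>g\<close> at \<open>z\<close>, then
        \<open>g\<close> lowered by one at \<open>z\<close> is still above \<open>h\<close>, hence
        an rhf by \<open>rhf_mono\<close>.\<close>
      fix z assume z: "z \<in> X" "h z \<noteq> g z"
      with h have less: "h z < g z" by (simp add: order_less_le)
      have "g z - 1 \<in> {0, 1, 2}" using PiE_mem[OF g z(1)] by auto
      then have "g(z := g z - 1) \<in> X \<rightarrow>\<^sub>E {0, 1, 2}"
        using g z(1) by (auto simp: PiE_iff extensional_def)
      moreover have "\<forall>x\<in>X. h x \<le> (g(z := g z - 1)) x" using h less by auto
      ultimately have "rhf X I s \<tau> (g(z := g z - 1))"
        using rhf_mono[OF assms] h by blast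
      with * z less show False by auto
    qed
  qed (use * in simp)
qed (simp add: minimal_rhf_def)


section \<open>Ranks of the extensions\<close>

text \<open>The functions \<open>g\<close> with \<open>f \<le> g \<le> 2\<close> on \<open>{..<n}\<close> are the numerals of a mixed radix number
  system, in which position \<open>x\<close> has \<open>3 - f x\<close> digits.\<close>

definition radix :: "(nat \<Rightarrow> nat) \<Rightarrow> nat \<Rightarrow> nat" where
  "radix f n = (\<Prod>x<n. 3 - f x)"

definition rank :: "(nat \<Rightarrow> nat) \<Rightarrow> nat \<Rightarrow> (nat \<Rightarrow> nat) \<Rightarrow> nat" where
  "rank f n g = (\<Sum>x<n. (g x - f x) * radix f x)"

lemma rank_cong: "(\<And>x. x < n \<Longrightarrow> g x = h x) \<Longrightarrow> rank f n g = rank f n h"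
  by (simp add: rank_def)

text \<open>The mixed radix form of the fact that a numeral of maximal digits is one below the next
  power of the base.\<close>

lemma rank_two: 
  assumes "\<forall>x<n. f x \<le> 2"
  shows "rank f n (\<lambda>_. 2) + 1 = radix f n"
  using assms
proof (induction n)
  case (Suc n)
  have "3 - f n = (2 - f n) + 1" using Suc.prems[rule_format, of n] by simp
  then have "radix f (Suc n) = (2 - f n) * radix f n + radix f n"
    by (simp add: radix_def)
  with Suc show ?case by (simp add: rank_def)
qed (simp add: rank_def radix_def)

lemma rank_less:
  assumes "\<forall>x<n. f x \<le> 2" "\<forall>x<n. g x \<le> 2"
  shows "rank f n g < radix f n"
proof -
  have "rank f n g \<le> rank f n (\<lambda>_. 2)"
    unfolding rank_def using assms(2) by (intro sum_mono mult_le_mono1) auto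
  with rank_two[OF assms(1)] show ?thesis by simp
qed

text \<open>By \<open>rank_less\<close> the lower positions stay below the weight
  \<open>radix f n\<close> of the leading one, so reduction modulo this weight splits off their
  rank.\<close>

lemma rank_inj:
  assumes "\<forall>x<n. f x \<le> g x \<and> g x \<le> 2" "\<forall>x<n. f x \<le> h x \<and> h x \<le> 2" "rank f n g = rank f n h"
  shows "\<forall>x<n. g x = h x"
  using assms
proof (induction n)
  case (Suc n)
  have le: "\<forall>x<n. f x \<le> 2" "\<forall>x<n. g x \<le> 2" "\<forall>x<n. h x \<le> 2"
    using Suc.prems(1,2) le_trans by (blast intro: less_SucI)+
  note l = rank_less[OF le(1,2)] rank_less[OF le(1,3)]
  have eq: "rank f n g + (g n - f n) * radix f n = rank f n h + (h n - f n) * radix f n"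
    using Suc.prems(3) by (simp add: rank_def)
  from arg_cong[OF this, of "\<lambda>t. t mod radix f n"] l have r: "rank f n g = rank f n h" by simp
  with eq l have "g n - f n = h n - f n" by auto
  moreover have "f n \<le> g n" "f n \<le> h n" using Suc.prems by auto
  ultimately have "g n = h n" by linarith
  moreover have "\<forall>x<n. g x = h x" using Suc r by simp
  ultimately show ?case by (simp add: less_Suc_eq)
qed simp

text \<open>The positions below \<open>x\<close> contribute \<open>radix f x - 1\<close> before and
  0 afterwards, while digit \<open>x\<close> gains one unit of weight
  \<open>radix f x\<close>.\<close>

lemma rank_increment:
  assumes "x < n" "\<forall>y<n. f y \<le> 2" "f x \<le> g x" "\<forall>y<x. g y = 2"
  shows "rank f n (\<lambda>y. if y < x then f y else if y = x then g x + 1 else g y) = rank f n g + 1"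
proof -
  let ?h = "\<lambda>y. if y < x then f y else if y = x then g x + 1 else g y"
  have split: "rank f n k = rank f x k + (k x - f x) * radix f x +
      (\<Sum>y\<in>{Suc x..<n}. (k y - f y) * radix f y)" for k
  proof -
    have "{..<n} = insert x {..<x} \<union> {Suc x..<n}" using assms(1) by auto
    moreover have "insert x {..<x} \<inter> {Suc x..<n} = {}" by auto
    ultimately show ?thesis
      by (simp add: rank_def sum.union_disjoint)
  qed
  have "rank f x ?h = 0" by (simp add: rank_def)
  moreover have "rank f x g + 1 = radix f x"
    using rank_two[of x f] rank_cong[of x g "\<lambda>_. 2" f] assms by auto
  moreover have "(\<Sum>y\<in>{Suc x..<n}. (?h y - f y) * radix f y) = (\<Sum>y\<in>{Suc x..<n}. (g y - f y) * radix f y)"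
    by (rule sum.cong) auto
  moreover have "(?h x - f x) * radix f x = (g x - f x) * radix f x + radix f x"
    using assms(3) by (simp add: Suc_diff_le)
  ultimately show ?thesis
    unfolding split[of ?h] split[of g] by linarith
qed

text \<open>A factor \<open>3 - f x\<close> is at most 3, and at most 1 once \<open>f x\<close>
  reaches 2.\<close>

lemma radix_le:
  "radix f n \<le> 3 ^ card {x. x < n \<and> f x < 2}"
proof (induction n)
  case (Suc n)
  have "{x. x < Suc n \<and> f x < 2} = {x. x < n \<and> f x < 2} \<union> (if f n < 2 then {n} else {})"
    by (auto simp: less_Suc_eq)
  then have "card {x. x < Suc n \<and> f x < 2} = card {x. x < n \<and> f x < 2} + of_bool (f n < 2)"
    by simp
  moreover have "3 - f n \<le> 3 ^ of_bool (f n < 2)"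
    by (auto simp: of_bool_def)
  ultimately show ?case
    using mult_le_mono[OF Suc.IH] by (simp add: radix_def power_add)
qed (simp add: radix_def)


section \<open>Programs\<close>

text \<open>Zero is false and everything else true. Truncated subtraction from 1 negates, and a
  double negation normalises a truth value to 0 or 1; bounded quantifiers become sums.\<close>

definition Neg :: "expr \<Rightarrow> expr" where
  "Neg e = Minus (Num 1) e"

definition And :: "expr \<Rightarrow> expr \<Rightarrow> expr" where
  "And e f = Neg (Plus (Neg e) (Neg f))"

definition Or :: "expr \<Rightarrow> expr \<Rightarrow> expr" where
  "Or e f = Neg (Neg (Plus e f))"

definition Ex :: "nat \<Rightarrow> nat \<Rightarrow> expr \<Rightarrow> expr" where
  "Ex x y e = Neg (Neg (Sum x y e))"

definition All :: "nat \<Rightarrow> nat \<Rightarrow> expr \<Rightarrow> expr" where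
  "All x y e = Neg (Sum x y (Neg e))"

definition Le :: "expr \<Rightarrow> expr \<Rightarrow> expr" where
  "Le e f = Neg (Minus e f)"

definition Eq :: "expr \<Rightarrow> expr \<Rightarrow> expr" where
  "Eq e f = And (Le e f) (Le f e)"

lemmas connective_defs = Neg_def And_def Or_def Ex_def All_def Le_def Eq_def

lemma val_Neg [simp]: "val v a (Neg e) = of_bool (val v a e = 0)"
  by (auto simp: Neg_def of_bool_def)

lemma val_connectives [simp]:
  "val v a (And e f) = of_bool (val v a e \<noteq> 0 \<and> val v a f \<noteq> 0)"
  "val v a (Or e f) = of_bool (val v a e \<noteq> 0 \<or> val v a f \<noteq> 0)"
  "val v a (Ex x y e) = of_bool (\<exists>k<v y. val (v(x := k)) a e \<noteq> 0)"
  "val v a (All x y e) = of_bool (\<forall>k<v y. val (v(x := k)) a e \<noteq> 0)"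
  "val v a (Le e f) = of_bool (val v a e \<le> val v a f)"
  "val v a (Eq e f) = of_bool (val v a e = val v a f)"
  by (auto simp: And_def Or_def Ex_def All_def Le_def Eq_def)

section \<open>Parsing a bit string into a list of numbers\<close>

lemma tab_snoc: "tab (cs @ [c]) = (tab cs)(length cs := c)"
  by (auto simp: tab_def fun_eq_iff nth_append)

text \<open>Variable 8 is the input position, 15 the symbol read there, 9 counts the current block of
  ones, and 10 is the number of array entries written. Later, 2 and 3 hold the numbers \<open>n\<close> of
  vertices and \<open>m\<close> of hyperedges, 12, 13 and 14 the positions in the array of the tables of
  \<open>\<tau>\<close>, \<open>f\<close> and \<open>g\<close>; a vertex is kept in 4 or 7, a hyperedge in 5.\<close>

definition parse :: code where
  "parse = input 15 8 ;;
     while (Minus (Num 2) (Var 15))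
       (ite (Var 15) (assign 9 (Plus (Var 9) (Num 1)))
         (store (Var 10) (Var 9) ;; assign 10 (Plus (Var 10) (Num 1)) ;; assign 9 (Num 0)) ;;
        assign 8 (Plus (Var 8) (Num 1)) ;; input 15 8)"

text \<open>The conjunct \<open>v 0 = 0\<close> is carried along because 0 is the output on rejected
  strings.\<close>

definition parsed :: "bool list \<Rightarrow> nat \<Rightarrow> store \<Rightarrow> store \<Rightarrow> bool" where
  "parsed w p v a \<longleftrightarrow> v 0 = 0 \<and> p \<le> length w \<and>
     (\<exists>cs. take p w = concat (map unary cs) @ replicate (v 9) True \<and> v 10 = length cs \<and> a = tab cs)"

lemma parsed_Suc:
  assumes "parsed w p v a" "p < length w"
  shows "w ! p \<Longrightarrow> parsed w (p + 1) (v(9 := v 9 + 1)) a"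
    and "\<not> w ! p \<Longrightarrow> parsed w (p + 1) (v(10 := v 10 + 1, 9 := 0)) (a(v 10 := v 9))"
proof -
  obtain cs where cs: "take p w = concat (map unary cs) @ replicate (v 9) True"
    "v 10 = length cs" "a = tab cs"
    using assms(1) by (auto simp: parsed_def)
  have take: "take (p + 1) w = take p w @ [w ! p]"
    using assms(2) by (simp add: take_Suc_conv_app_nth)
  show "parsed w (p + 1) (v(9 := v 9 + 1)) a" if "w ! p"
    using assms cs take that
    by (auto simp: parsed_def replicate_append_same simp flip: replicate_Suc)
  show "parsed w (p + 1) (v(10 := v 10 + 1, 9 := 0)) (a(v 10 := v 9))" if "\<not> w ! p"
    unfolding parsed_def
    using assms cs take that
    by (intro conjI exI[of _ "cs @ [v 9]"]) (auto simp: parsed_def tab_snoc unary_def)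
qed

lemma triple_parse:
  "triple w (\<lambda>v a. v = (\<lambda>_. 0) \<and> a = (\<lambda>_. 0)) parse (100 * length w + 100) (parsed w (length w))"
proof -
  let ?I = "\<lambda>v a. parsed w (v 8) v a \<and> v 15 = input_symbol w (v 8)"
  let ?N = "length w"
  let ?e = "Minus (Num 2) (Var 15)"
  let ?c = "ite (Var 15) (assign 9 (Plus (Var 9) (Num 1)))
         (store (Var 10) (Var 9) ;; assign 10 (Plus (Var 10) (Num 1)) ;; assign 9 (Num 0)) ;;
        assign 8 (Plus (Var 8) (Num 1)) ;; input 15 8"
  have body: "triple w (\<lambda>v a. ?I v a \<and> val v a ?e \<noteq> 0 \<and> ?N - v 8 = k) ?c 50
      (\<lambda>v a. ?I v a \<and> ?N - v 8 < k)" for k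
  proof -
    \<comment> \<open>The guard \<open>2 - v 15\<close> is nonzero exactly on a bit; past the end of
      the input the symbol is 2.\<close>
    let ?P = "\<lambda>v a. ?I v a \<and> v 15 < 2 \<and> ?N - v 8 = k"
    \<comment> \<open>Between the two halves of the body the parsed prefix is one symbol ahead of
      the position in variable 8.\<close>
    let ?Q = "\<lambda>v a. parsed w (v 8 + 1) v a \<and> v 8 < ?N \<and> ?N - v 8 = k"
    have P: "v 8 < ?N \<and> v 15 = of_bool (w ! v 8)" if "?P v a" for v a
      using that by (auto simp: input_symbol_def split: if_splits)
    have one: "triple w (\<lambda>v a. ?P v a \<and> val v a (Var 15) \<noteq> 0) (assign 9 (Plus (Var 9) (Num 1)))
        (cost ?N (Plus (Var 9) (Num 1)) + 2) ?Q"
    proof (rule triple_pre[OF triple_assign])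
      fix v a assume *: "?P v a \<and> val v a (Var 15) \<noteq> 0"
      with P[of v a] have "v 8 < ?N" "w ! v 8" by auto
      with * parsed_Suc(1)[of w "v 8" v a]
      show "(\<forall>y\<in>bound_vars (Plus (Var 9) (Num 1)). v y \<le> ?N) \<and>
          ?Q (v(9 := val v a (Plus (Var 9) (Num 1)))) a" by simp
    qed auto
    have zero: "triple w (\<lambda>v a. ?P v a \<and> val v a (Var 15) = 0)
        (store (Var 10) (Var 9) ;; assign 10 (Plus (Var 10) (Num 1)) ;; assign 9 (Num 0))
        (cost ?N (Var 10) + cost ?N (Var 9) + 3 + (cost ?N (Plus (Var 10) (Num 1)) + 2 +
          (cost ?N (Num 0) + 2))) ?Q"
    proof (rule triple_pre[OF triple_seq[OF triple_store triple_seq[OF triple_assign triple_assign]]])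
      fix v a assume *: "?P v a \<and> val v a (Var 15) = 0"
      with P[of v a] have "v 8 < ?N" "\<not> w ! v 8" by auto
      with * parsed_Suc(2)[of w "v 8" v a]
      show "(\<forall>y\<in>bound_vars (Var 10) \<union> bound_vars (Var 9). v y \<le> ?N) \<and>
          (\<forall>y\<in>bound_vars (Plus (Var 10) (Num 1)). v y \<le> ?N) \<and>
          (\<forall>y\<in>bound_vars (Num 0). (v(10 := val v (a(val v a (Var 10) := val v a (Var 9))) (Plus (Var 10) (Num 1)))) y \<le> ?N) \<and>
          ?Q (v(10 := val v (a(val v a (Var 10) := val v a (Var 9))) (Plus (Var 10) (Num 1)),
               9 := val (v(10 := val v (a(val v a (Var 10) := val v a (Var 9))) (Plus (Var 10) (Num 1))))
                   (a(val v a (Var 10) := val v a (Var 9))) (Num 0)))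
            (a(val v a (Var 10) := val v a (Var 9)))"
        by simp
    qed auto
    have next_symbol: "triple w ?Q (assign 8 (Plus (Var 8) (Num 1)) ;; input 15 8)
        (cost ?N (Plus (Var 8) (Num 1)) + 2 + 1) (\<lambda>v a. ?I v a \<and> ?N - v 8 < k)"
      by (rule triple_pre[OF triple_seq[OF triple_assign triple_input]]) (auto simp: parsed_def)
    show ?thesis
      by (rule triple_weaken[OF triple_seq[OF triple_ite[OF _ _ one zero] next_symbol]]) auto
  qed
  have "triple w (\<lambda>v a. ?I v a \<and> ?N - v 8 \<le> ?N) (while ?e ?c) (?N * (cost ?N ?e + 50 + 2) + cost ?N ?e + 1)
      (\<lambda>v a. ?I v a \<and> val v a ?e = 0)"
    by (rule triple_while[OF _ _ body]) auto
  then have "triple w (\<lambda>v a. v = (\<lambda>_. 0) \<and> a = (\<lambda>_. 0)) parse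
      (1 + (?N * (cost ?N ?e + 50 + 2) + cost ?N ?e + 1)) (\<lambda>v a. ?I v a \<and> val v a ?e = 0)"
    unfolding parse_def
    by (intro triple_seq[OF triple_pre[OF triple_input]])
      (auto simp: parsed_def tab_def fun_eq_iff intro!: exI[of _ "[]"])
  then show ?thesis
  proof (rule triple_weaken)
    fix v a assume *: "?I v a \<and> val v a ?e = 0"
    then have "v 8 = ?N"
      by (auto simp: parsed_def input_symbol_def of_bool_def split: if_splits)
    with * show "parsed w ?N v a" by simp
  qed auto
qed

section \<open>Validation of the parsed list\<close>

text \<open>The row offset \<open>i * n\<close> is the sum of \<open>n\<close> over \<open>i\<close>
  terms; variable 6 only counts them.\<close>

definition mat_expr :: expr where
  "mat_expr = Arr (Plus (Plus (Num 2) (Sum 6 5 (Var 2))) (Var 4))"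

definition corr_expr :: expr where
  "corr_expr = Arr (Plus (Var 12) (Var 4))"

definition base_expr :: expr where
  "base_expr = Arr (Plus (Var 13) (Var 4))"

definition setup_code :: code where
  "setup_code = assign 2 (Arr (Num 0)) ;; assign 3 (Arr (Num 1)) ;;
     assign 12 (Plus (Num 2) (Sum 6 3 (Var 2))) ;; assign 13 (Plus (Var 12) (Var 2)) ;;
     assign 14 (Plus (Var 13) (Var 2))"

definition valid_expr :: expr where
  "valid_expr = And (Eq (Var 9) (Num 0)) (And (Le (Num 2) (Var 10)) (And (Eq (Var 10) (Var 14))
     (And (All 5 3 (All 4 2 (Le mat_expr (Num 1))))
       (All 4 2 (And (Ex 5 3 (And (Eq corr_expr (Var 5)) mat_expr)) (Le base_expr (Num 2)))))))"

definition layout :: "nat \<Rightarrow> nat \<Rightarrow> store \<Rightarrow> bool" where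
  "layout n m v \<longleftrightarrow> v 2 = n \<and> v 3 = m \<and> v 12 = 2 + m * n \<and> v 13 = 2 + m * n + n \<and>
     v 14 = 2 + m * n + n + n"

lemma val_valid_expr:
  assumes "layout (tab cs 0) (tab cs 1) v" "v 10 = length cs"
  shows "val v (tab cs) valid_expr = of_bool (v 9 = 0 \<and> valid_code cs)"
  using assms
  by (simp add: valid_expr_def mat_expr_def corr_expr_def base_expr_def layout_def valid_code_def Let_def)

text \<open>The only sum is the product \<open>m * n\<close>, taken with variable 3 as limit, hence
  the bound on \<open>a 1\<close>.\<close>

lemma triple_setup:
  assumes "\<And>v a. P v a \<Longrightarrow> a 1 \<le> N"
    and "\<And>v a n m. P v a \<Longrightarrow>
      Q (v(2 := a 0, 3 := a 1, 12 := 2 + a 1 * a 0, 13 := 2 + a 1 * a 0 + a 0,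
           14 := 2 + a 1 * a 0 + a 0 + a 0)) a"
  shows "triple w P setup_code (100 * N + 100) Q"
  unfolding setup_code_def
  by (rule triple_weaken[OF triple_seq[OF triple_assign[where N = N] triple_seq[OF triple_assign[where N = N]
        triple_seq[OF triple_assign[where N = N] triple_seq[OF triple_assign[where N = N]
        triple_assign[where N = N]]]]]])
    (use assms in auto)

section \<open>Programs that run on valid encodings only\<close>

text \<open>Only the entries below \<open>v 14\<close> are prescribed, which leaves the array from
  there on free for the candidate \<open>g\<close>.\<close>

definition ready :: "erhf_instance \<Rightarrow> store \<Rightarrow> store \<Rightarrow> bool" where
  "ready E v a \<longleftrightarrow> layout (num_vertices E) (num_edges E) v \<and>
     (\<forall>j<v 14. a j = tab (erhf_code E) j)"

text \<open>A common front end for the decision program and the program that computes the parameter;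
  invalid input leaves the output 0.\<close>

definition on_instance :: "code \<Rightarrow> code" where
  "on_instance c = (parse ;; setup_code) ;; ite valid_expr c skip"

text \<open>Parsing and setup take at most \<open>100 * N + 100\<close> each; the final 3 pays for
  the branching and for \<open>skip\<close>.\<close>

definition front_time :: "nat \<Rightarrow> nat" where
  "front_time N = 200 * N + 200 + cost N valid_expr + 3"

lemma poly_bounded_front_time: "poly_bounded front_time"
  unfolding front_time_def[abs_def] by (intro poly_bounded_intros)

definition loaded :: "bool list \<Rightarrow> nat list \<Rightarrow> store \<Rightarrow> store \<Rightarrow> bool" where
  "loaded w cs v a \<longleftrightarrow> w = concat (map unary cs) @ replicate (v 9) True \<and> v 10 = length cs \<and>
     a = tab cs \<and> v 0 = 0 \<and> layout (tab cs 0) (tab cs 1) v \<and> v 2 \<le> length w \<and> v 3 \<le> length w"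

lemma triple_front:
  "triple w (\<lambda>v a. v = (\<lambda>_. 0) \<and> a = (\<lambda>_. 0)) (parse ;; setup_code) (200 * length w + 200)
    (\<lambda>v a. \<exists>cs. loaded w cs v a)"
proof (rule triple_weaken[OF triple_seq[OF triple_parse triple_setup[where N = "length w"]]])
  fix v a assume "parsed w (length w) v a"
  then obtain cs where cs: "w = concat (map unary cs) @ replicate (v 9) True" "v 10 = length cs"
    "a = tab cs" "v 0 = 0"
    by (auto simp: parsed_def)
  have le: "tab cs j \<le> length w" for j
    using entry_le_length_concat_unary[of "cs ! j" cs]
    by (subst cs(1)) (auto simp: tab_def intro: trans_le_add1)
  then show "a 1 \<le> length w" by (simp add: cs(3))
  have "loaded w cs (v(2 := a 0, 3 := a 1, 12 := 2 + a 1 * a 0, 13 := 2 + a 1 * a 0 + a 0,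
      14 := 2 + a 1 * a 0 + a 0 + a 0)) a"
    using cs le unfolding loaded_def by (auto simp: layout_def)
  then show "\<exists>cs. loaded w cs (v(2 := a 0, 3 := a 1, 12 := 2 + a 1 * a 0, 13 := 2 + a 1 * a 0 + a 0,
      14 := 2 + a 1 * a 0 + a 0 + a 0)) a" by blast
qed auto

lemma fits_valid_expr: "fits 20 valid_expr"
  by (simp add: valid_expr_def mat_expr_def corr_expr_def base_expr_def connective_defs)

lemma bound_vars_valid_expr: "bound_vars valid_expr \<subseteq> {2, 3}"
  by (auto simp: valid_expr_def mat_expr_def corr_expr_def base_expr_def connective_defs)

lemma loaded_bounds: "\<exists>cs. loaded w cs v a \<Longrightarrow> \<forall>y\<in>bound_vars valid_expr. v y \<le> length w"
  using bound_vars_valid_expr by (auto simp: loaded_def)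

lemma val_valid_expr_loaded:
  "loaded w cs v a \<Longrightarrow> val v a valid_expr = of_bool (v 9 = 0 \<and> valid_code cs)"
  using val_valid_expr[of cs v] by (simp add: loaded_def)

lemma on_instance_invalid:
  assumes "w \<notin> erhf_encode ` erhf_instances"
  shows "triple w (\<lambda>v a. v = (\<lambda>_. 0) \<and> a = (\<lambda>_. 0)) (on_instance c) (front_time (length w))
    (\<lambda>v a. v 0 = 0)"
proof -
  have "val v a valid_expr = 0" if l: "loaded w cs v a" for v a cs
  proof (rule ccontr)
    assume "val v a valid_expr \<noteq> 0"
    then have cs: "v 9 = 0" "valid_code cs"
      by (simp_all add: val_valid_expr_loaded[OF l])
    then have "w = erhf_encode (decode_code cs)"
      using l decode_code(2)[of cs] by (simp add: loaded_def erhf_encode_def)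
    with assms decode_code(1)[OF cs(2)] show False by blast
  qed
  \<comment> \<open>The branch \<open>c\<close> is never entered, so its triple holds vacuously,
    even with time 0.\<close>
  then have yes: "triple w (\<lambda>v a. (\<exists>cs. loaded w cs v a) \<and> val v a valid_expr \<noteq> 0) c 0 (\<lambda>v a. v 0 = 0)"
    by (auto simp: triple_def)
  have no: "triple w (\<lambda>v a. (\<exists>cs. loaded w cs v a) \<and> val v a valid_expr = 0) skip 1 (\<lambda>v a. v 0 = 0)"
    by (rule triple_pre[OF triple_skip]) (auto simp: loaded_def)
  show ?thesis
    unfolding on_instance_def
    by (rule triple_weaken[OF triple_seq[OF triple_front triple_ite[OF fits_valid_expr loaded_bounds yes no]]])
      (auto simp: front_time_def)
qed

lemma on_instance_valid:
  assumes E: "E \<in> erhf_instances" and w: "w = erhf_encode E"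
    and c: "triple w (\<lambda>v a. ready E v a \<and> v 0 = 0 \<and> v 2 \<le> length w \<and> v 3 \<le> length w) c T Q"
  shows "triple w (\<lambda>v a. v = (\<lambda>_. 0) \<and> a = (\<lambda>_. 0)) (on_instance c) (front_time (length w) + T) Q"
proof -
  \<comment> \<open>An encoding is parsed without dangling ones, and into the code of
    \<open>E\<close> itself.\<close>
  have cs: "v 9 = 0 \<and> cs = erhf_code E" if "loaded w cs v a" for v a cs
    using that concat_unary_replicate_inj[of "erhf_code E" cs "v 9"]
    by (simp add: loaded_def w erhf_encode_def)
  have "val v a valid_expr \<noteq> 0" if "loaded w cs v a" for v a cs
    using val_valid_expr_loaded[OF that] cs[OF that] valid_code_erhf_code[OF E] by simp
  then have no: "triple w (\<lambda>v a. (\<exists>cs. loaded w cs v a) \<and> val v a valid_expr = 0) skip 0 Q"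
    unfolding triple_def by (metis (no_types, lifting))
  have yes: "triple w (\<lambda>v a. (\<exists>cs. loaded w cs v a) \<and> val v a valid_expr \<noteq> 0) c T Q"
  proof (rule triple_pre[OF c])
    fix v a assume "(\<exists>cs. loaded w cs v a) \<and> val v a valid_expr \<noteq> 0"
    then have "loaded w (erhf_code E) v a" using cs by blast
    then show "ready E v a \<and> v 0 = 0 \<and> v 2 \<le> length w \<and> v 3 \<le> length w"
      unfolding loaded_def ready_def tab_erhf_code(1,2) by blast
  qed
  show ?thesis
    unfolding on_instance_def
    by (rule triple_weaken[OF triple_seq[OF triple_front triple_ite[OF fits_valid_expr loaded_bounds yes no]]])
      (auto simp: front_time_def)
qed


section \<open>Enumeration of the extensions\<close>

definition ext_expr :: expr where
  "ext_expr = Arr (Plus (Var 14) (Var 4))"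

text \<open>The argument \<open>e\<close> gives the value of the tested function at the vertex in
  variable 4, so the candidate and its lowerings share one test.\<close>

definition rhf_expr :: "expr \<Rightarrow> expr" where
  "rhf_expr e = All 5 3 (Or (Ex 4 2 (And mat_expr (Eq e (Num 2))))
     (Ex 4 2 (And (Eq corr_expr (Var 5)) (Eq e (Num 1)))))"

text \<open>Subtracting the truth value of the equality of variables 4 and 7 lowers \<open>g\<close>
  by one at the vertex in variable 7 without touching the array.\<close>

definition minimal_expr :: expr where
  "minimal_expr = And (rhf_expr ext_expr)
     (All 7 2 (Or (Eq (Arr (Plus (Var 14) (Var 7))) (Num 0))
       (Neg (rhf_expr (Minus ext_expr (Eq (Var 4) (Var 7)))))))"

lemma ready_upd [simp]:
  "x \<notin> {2, 3, 12, 13, 14} \<Longrightarrow> ready E (v(x := k)) a \<longleftrightarrow> ready E v a"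
  by (simp add: ready_def layout_def)

lemma ready_array_upd:
  "v 14 \<le> j \<Longrightarrow> ready E v (a(j := k)) \<longleftrightarrow> ready E v a"
  by (simp add: ready_def)

lemma ready_vars:
  assumes "ready E v a"
  shows "v 2 = num_vertices E" "v 3 = num_edges E"
  using assms by (simp_all add: ready_def layout_def)

lemma ready_val:
  assumes "ready E v a" "v 4 < num_vertices E"
  shows "v 5 < num_edges E \<Longrightarrow> val v a mat_expr = of_bool (v 4 \<in> edge_sets E (v 5))"
    and "val v a corr_expr = corr E (v 4)"
    and "val v a base_expr = base_fun E (v 4)"
proof -
  have v: "v 2 = num_vertices E" "v 3 = num_edges E" "v 12 = 2 + num_edges E * num_vertices E"
    "v 13 = 2 + num_edges E * num_vertices E + num_vertices E"
    "v 14 = 2 + num_edges E * num_vertices E + num_vertices E + num_vertices E"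
    and a: "\<And>j. j < v 14 \<Longrightarrow> a j = tab (erhf_code E) j"
    using assms(1) by (simp_all add: ready_def layout_def)
  show "val v a mat_expr = of_bool (v 4 \<in> edge_sets E (v 5))" if "v 5 < num_edges E"
  proof -
    have "val v a mat_expr = a (2 + v 5 * num_vertices E + v 4)"
      by (simp add: mat_expr_def v)
    also have "\<dots> = of_bool (v 4 \<in> edge_sets E (v 5))"
      using mult_add_less[OF that assms(2)] tab_erhf_code(3)[OF that assms(2)] by (subst a) (simp_all add: v)
    finally show ?thesis .
  qed
  show "val v a corr_expr = corr E (v 4)"
    using assms(2) tab_erhf_code(4)[OF assms(2)] a[of "2 + num_edges E * num_vertices E + v 4"]
    by (simp add: corr_expr_def v)
  show "val v a base_expr = base_fun E (v 4)"
    using assms(2) tab_erhf_code(5)[OF assms(2)]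
      a[of "2 + num_edges E * num_vertices E + num_vertices E + v 4"]
    by (simp add: base_expr_def v)
qed

lemma val_rhf_expr:
  assumes E: "E \<in> erhf_instances" and ready: "ready E v a"
    and e: "\<And>i x. x < num_vertices E \<Longrightarrow> val (v(5 := i, 4 := x)) a e = h x"
    and h: "h \<in> verts E \<rightarrow>\<^sub>E {0, 1, 2}"
  shows "val v a (rhf_expr e) \<noteq> 0 \<longleftrightarrow> rhf (verts E) (edges E) (edge_sets E) (corr E) h"
proof -
  have sub: "edge_sets E i \<subseteq> verts E" if "i < num_edges E" for i
    using E that by (auto simp: erhf_instances_def hypergraph_def edges_def)
  have r: "ready E (v(5 := i, 4 := x)) a" for i x
    using ready by simp
  have m: "val (v(5 := i, 4 := x)) a mat_expr = of_bool (x \<in> edge_sets E i)"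
    "val (v(5 := i, 4 := x)) a corr_expr = corr E x" if "i < num_edges E" "x < num_vertices E" for i x
    using ready_val[OF r[of i x]] that by simp_all
  have "val v a (rhf_expr e) \<noteq> 0 \<longleftrightarrow> (\<forall>i<num_edges E.
      (\<exists>x<num_vertices E. x \<in> edge_sets E i \<and> h x = 2) \<or>
      (\<exists>x<num_vertices E. corr E x = i \<and> h x = 1))"
    using m e by (auto simp: rhf_expr_def ready_vars[OF ready])
  also have "\<dots> \<longleftrightarrow> rhf (verts E) (edges E) (edge_sets E) (corr E) h"
  proof -
    have "(\<exists>x<num_vertices E. x \<in> edge_sets E i \<and> h x = 2) \<longleftrightarrow> (\<exists>x. x \<in> edge_sets E i \<and> h x = 2)"
      if "i < num_edges E" for i
      using sub[OF that] by (auto simp: verts_def)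
    then show ?thesis
      using h unfolding rhf_def verts_def edges_def Ball_def Bex_def lessThan_iff by blast
  qed
  finally show ?thesis .
qed

definition tabulates :: "erhf_instance \<Rightarrow> (nat \<Rightarrow> nat) \<Rightarrow> store \<Rightarrow> store \<Rightarrow> bool" where
  "tabulates E g v a \<longleftrightarrow> ready E v a \<and> (\<forall>x<num_vertices E. a (v 14 + x) = g x)"

text \<open>The array provides \<open>g\<close> on the vertices only; \<open>restrict\<close> turns
  it into the extensional function that \<open>rhf\<close> expects.\<close>

definition minimal_on :: "erhf_instance \<Rightarrow> (nat \<Rightarrow> nat) \<Rightarrow> bool" where
  "minimal_on E g \<longleftrightarrow> minimal_rhf (verts E) (edges E) (edge_sets E) (corr E) (restrict g (verts E))"

lemma val_minimal_expr:
  assumes E: "E \<in> erhf_instances" and g: "\<forall>x<num_vertices E. g x \<le> 2" and t: "tabulates E g v a"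
  shows "val v a minimal_expr = of_bool (minimal_on E g)"
proof -
  let ?g = "restrict g (verts E)"
  have ready: "ready E v a" and a: "\<And>x. x < num_vertices E \<Longrightarrow> a (v 14 + x) = g x"
    using t by (auto simp: tabulates_def)
  have hyp: "hypergraph (verts E) (edges E) (edge_sets E)"
    "correspondence (verts E) (edges E) (edge_sets E) (corr E)"
    using E by (simp_all add: erhf_instances_def)
  have le2: "k \<le> 2 \<Longrightarrow> k \<in> {0, 1, 2}" for k :: nat by auto
  have gE: "?g \<in> verts E \<rightarrow>\<^sub>E {0, 1, 2}"
    using g le2 by (auto simp: verts_def)
  have 1: "val v a (rhf_expr ext_expr) \<noteq> 0 \<longleftrightarrow> rhf (verts E) (edges E) (edge_sets E) (corr E) ?g"
    by (rule val_rhf_expr[OF E ready _ gE]) (simp add: ext_expr_def a verts_def)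
  have 2: "val (v(7 := z)) a (rhf_expr (Minus ext_expr (Eq (Var 4) (Var 7)))) \<noteq> 0 \<longleftrightarrow>
      rhf (verts E) (edges E) (edge_sets E) (corr E) (?g(z := ?g z - 1))" if z: "z < num_vertices E" for z
  proof (rule val_rhf_expr[OF E])
    show "ready E (v(7 := z)) a" using ready by simp
    show "val (v(7 := z, 5 := i, 4 := x)) a (Minus ext_expr (Eq (Var 4) (Var 7))) = (?g(z := ?g z - 1)) x"
      if "x < num_vertices E" for i x
      using that by (simp add: ext_expr_def a verts_def)
    show "?g(z := ?g z - 1) \<in> verts E \<rightarrow>\<^sub>E {0, 1, 2}"
      using gE z le2[of "?g z - 1"] g by (auto simp: verts_def PiE_iff extensional_def)
  qed
  show ?thesis
    unfolding minimal_on_def minimal_rhf_iff[OF hyp] minimal_expr_def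
    using 1 2 a by (auto simp: ready_vars[OF ready] verts_def)
qed

definition extends :: "erhf_instance \<Rightarrow> (nat \<Rightarrow> nat) \<Rightarrow> bool" where
  "extends E g \<longleftrightarrow> (\<forall>x<num_vertices E. base_fun E x \<le> g x \<and> g x \<le> 2)"

lemma minimal_on_cong: "(\<forall>x<num_vertices E. g x = h x) \<Longrightarrow> minimal_on E g = minimal_on E h"
  unfolding minimal_on_def by (metis lessThan_iff restrict_ext verts_def)

lemma erhf_yes_iff: "erhf_yes E \<longleftrightarrow> (\<exists>g. extends E g \<and> minimal_on E g)"
proof
  assume "erhf_yes E"
  then obtain g where g: "minimal_rhf (verts E) (edges E) (edge_sets E) (corr E) g"
    "\<forall>x\<in>verts E. base_fun E x \<le> g x"
    by (auto simp: erhf_yes_def rhf_extendable_def)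
  then have gE: "g \<in> verts E \<rightarrow>\<^sub>E {0, 1, 2}" by (simp add: minimal_rhf_def rhf_def)
  have "g x \<le> 2" if "x < num_vertices E" for x
    using PiE_mem[OF gE, of x] that by (auto simp: verts_def)
  then show "\<exists>g. extends E g \<and> minimal_on E g"
    using g PiE_restrict[OF gE] by (intro exI[of _ g]) (auto simp: extends_def minimal_on_def verts_def)
next
  assume "\<exists>g. extends E g \<and> minimal_on E g"
  then obtain g where "extends E g" "minimal_on E g" by blast
  then show "erhf_yes E"
    unfolding erhf_yes_def rhf_extendable_def
    by (intro exI[of _ "restrict g (verts E)"]) (auto simp: extends_def minimal_on_def verts_def)
qed

text \<open>Variable 11 is cleared when all extensions have been tested.\<close>

definition carry_guard :: expr where
  "carry_guard = And (Minus (Var 2) (Var 4)) (Eq ext_expr (Num 2))"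

text \<open>Digits equal to 2 overflow: they return to their base value until a digit that can be
  raised, or the end, is reached.\<close>

definition carry_code :: code where
  "carry_code = while carry_guard
     (store (Plus (Var 14) (Var 4)) base_expr ;; assign 4 (Plus (Var 4) (Num 1)))"

text \<open>The current candidate is tested before it is incremented. A carry out of the last digit
  means that it was the constant 2, the last one.\<close>

definition step_code :: code where
  "step_code = assign 0 (Or (Var 0) minimal_expr) ;; assign 4 (Num 0) ;; carry_code ;;
     ite (Minus (Var 2) (Var 4)) (store (Plus (Var 14) (Var 4)) (Plus ext_expr (Num 1)))
       (assign 11 (Num 0))"

definition init_code :: code where
  "init_code = assign 4 (Num 0) ;;
     while (Minus (Var 2) (Var 4))
       (store (Plus (Var 14) (Var 4)) base_expr ;; assign 4 (Plus (Var 4) (Num 1)))"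

definition enum_code :: code where
  "enum_code = init_code ;; assign 11 (Num 1) ;; while (Var 11) step_code"

definition step_time :: "nat \<Rightarrow> nat" where
  "step_time N = cost N (Or (Var 0) minimal_expr) + N * 200 + 200"

lemma base_le_two:
  assumes "E \<in> erhf_instances" "x < num_vertices E"
  shows "base_fun E x \<le> 2"
proof -
  have "base_fun E \<in> verts E \<rightarrow>\<^sub>E {0, 1, 2}"
    using assms(1) by (simp add: erhf_instances_def)
  from PiE_mem[OF this, of x] show ?thesis
    using assms(2) by (auto simp: verts_def)
qed

lemma fits_enum: 
  "fits 20 (Or (Var 0) minimal_expr)" "fits 20 carry_guard" "fits 20 base_expr" "fits 21 base_expr"
  "fits 21 (Plus ext_expr (Num 1))" "fits 20 (Plus (Var 14) (Var 4))"
  by (simp_all add: minimal_expr_def carry_guard_def rhf_expr_def mat_expr_def corr_expr_def base_expr_def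
      ext_expr_def connective_defs)

lemma bound_vars_enum:
  "bound_vars (Or (Var 0) minimal_expr) \<subseteq> {2, 3}" "bound_vars carry_guard = {}"
  "bound_vars base_expr = {}" "bound_vars ext_expr = {}"
  by (auto simp: minimal_expr_def carry_guard_def rhf_expr_def mat_expr_def corr_expr_def base_expr_def
      ext_expr_def connective_defs)

lemma cost_enum:
  "cost N carry_guard \<le> 50" "cost N base_expr = 8" "cost N ext_expr = 8"
  by (simp_all add: carry_guard_def base_expr_def ext_expr_def connective_defs)

lemma triple_copy_step:
  assumes P: "\<And>v a. P v a \<Longrightarrow> ready E v a \<and> v 4 < num_vertices E"
    and Q: "\<And>v a. P v a \<Longrightarrow> Q (v(4 := v 4 + 1)) (a(v 14 + v 4 := base_fun E (v 4)))"
  shows "triple w P (store (Plus (Var 14) (Var 4)) base_expr ;; assign 4 (Plus (Var 4) (Num 1))) 30 Q"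
\<comment> \<open>These expressions contain no sums, so \<open>N = 0\<close> is a legitimate bound
  on their limits.\<close>
proof (rule triple_weaken[OF triple_seq[OF triple_store[OF fits_enum(6,4), where N = 0]
      triple_assign[where N = 0]]])
  fix v a assume *: "P v a"
  then have "val v a base_expr = base_fun E (v 4)"
    using P[OF *] ready_val(3) by blast
  with Q[OF *] show "(\<forall>y\<in>bound_vars (Plus (Var 14) (Var 4)) \<union> bound_vars base_expr. v y \<le> 0) \<and>
      (\<forall>y\<in>bound_vars (Plus (Var 4) (Num 1)). v y \<le> 0) \<and>
      Q (v(4 := val v (a(val v a (Plus (Var 14) (Var 4)) := val v a base_expr)) (Plus (Var 4) (Num 1))))
        (a(val v a (Plus (Var 14) (Var 4)) := val v a base_expr))"
    by (simp add: bound_vars_enum)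
qed (auto simp: cost_enum)

lemma triple_init:
  assumes "E \<in> erhf_instances" "num_vertices E \<le> N"
  shows "triple w (\<lambda>v a. ready E v a \<and> v 0 = 0) init_code (N * 50 + 50)
    (\<lambda>v a. tabulates E (base_fun E) v a \<and> v 0 = 0)"
proof -
  let ?I = "\<lambda>v a. ready E v a \<and> v 0 = 0 \<and> v 4 \<le> num_vertices E \<and> (\<forall>x<v 4. a (v 14 + x) = base_fun E x)"
  let ?c = "store (Plus (Var 14) (Var 4)) base_expr ;; assign 4 (Plus (Var 4) (Num 1))"
  let ?e = "Minus (Var 2) (Var 4)"
  have body: "triple w (\<lambda>v a. ?I v a \<and> val v a ?e \<noteq> 0 \<and> num_vertices E - v 4 = k) ?c 30
      (\<lambda>v a. ?I v a \<and> num_vertices E - v 4 < k)" for k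
    by (rule triple_copy_step[where E = E])
      (auto simp: ready_vars ready_array_upd less_Suc_eq)
  have loop: "triple w (\<lambda>v a. ?I v a \<and> num_vertices E - v 4 \<le> N) (while ?e ?c)
      (N * (cost N ?e + 30 + 2) + cost N ?e + 1) (\<lambda>v a. ?I v a \<and> val v a ?e = 0)"
    by (rule triple_while[OF _ _ body]) auto
  show ?thesis
    unfolding init_code_def
    by (rule triple_weaken[OF triple_seq[OF triple_assign[where N = N] loop]])
      (use assms in \<open>auto simp: tabulates_def ready_vars\<close>)
qed

section \<open>Correctness of the enumeration\<close>

text \<open>Candidates are visited in the order of their ranks, so this is the answer accumulated in
  variable 0 when the candidate of rank \<open>r\<close> is due.\<close>

definition found_below :: "erhf_instance \<Rightarrow> nat \<Rightarrow> bool" where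
  "found_below E r \<longleftrightarrow>
     (\<exists>h. extends E h \<and> rank (base_fun E) (num_vertices E) h < r \<and> minimal_on E h)"

text \<open>By \<open>rank_inj\<close> the extensions of the same rank as \<open>g\<close> agree
  with it on the vertices, and minimality depends on these values only.\<close>

lemma found_below_Suc:
  assumes "extends E g"
  shows "found_below E (rank (base_fun E) (num_vertices E) g + 1) \<longleftrightarrow>
    found_below E (rank (base_fun E) (num_vertices E) g) \<or> minimal_on E g"
proof -
  have "minimal_on E g"
    if "extends E h" "rank (base_fun E) (num_vertices E) h = rank (base_fun E) (num_vertices E) g" "minimal_on E h" for h
    using minimal_on_cong[OF rank_inj[OF that(1)[unfolded extends_def] assms[unfolded extends_def] that(2)]]
      that(3) by simp
  then show ?thesis
    using assms unfolding found_below_def less_Suc_eq Suc_eq_plus1[symmetric] by blast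
qed

lemma found_below_radix:
  assumes "E \<in> erhf_instances"
  shows "found_below E (radix (base_fun E) (num_vertices E)) \<longleftrightarrow> erhf_yes E"
proof -
  have "rank (base_fun E) (num_vertices E) h < radix (base_fun E) (num_vertices E)" if "extends E h" for h
    by (rule rank_less) (use that base_le_two[OF assms] in \<open>auto simp: extends_def\<close>)
  then show ?thesis
    unfolding found_below_def erhf_yes_iff by blast
qed

definition enum_inv :: "erhf_instance \<Rightarrow> store \<Rightarrow> store \<Rightarrow> bool" where
  "enum_inv E v a \<longleftrightarrow> (\<exists>g. extends E g \<and> tabulates E g v a \<and>
     (v 11 = 1 \<and> v 0 = of_bool (found_below E (rank (base_fun E) (num_vertices E) g)) \<or>
      v 11 = 0 \<and> v 0 = of_bool (erhf_yes E)))"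

text \<open>The number of candidates still to be tested, including the current one; this is the
  termination measure of the main loop.\<close>

definition remaining :: "erhf_instance \<Rightarrow> store \<Rightarrow> store \<Rightarrow> nat" where
  "remaining E v a = (if v 11 = 0 then 0 else radix (base_fun E) (num_vertices E) -
     rank (base_fun E) (num_vertices E) (\<lambda>x. a (v 14 + x)))"

lemma triple_carry:
  assumes "num_vertices E \<le> N"
  shows "triple w (\<lambda>v a. tabulates E g v a \<and> v 4 = 0 \<and> v 11 = 1 \<and> v 0 = r) carry_code (N * 100 + 100)
    (\<lambda>v a. tabulates E (\<lambda>x. if x < v 4 then base_fun E x else g x) v a \<and> v 4 \<le> num_vertices E \<and>
       (\<forall>x<v 4. g x = 2) \<and> (v 4 < num_vertices E \<longrightarrow> g (v 4) \<noteq> 2) \<and> v 11 = 1 \<and> v 0 = r)"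
proof -
  let ?I = "\<lambda>v a. tabulates E (\<lambda>x. if x < v 4 then base_fun E x else g x) v a \<and> v 4 \<le> num_vertices E \<and>
       (\<forall>x<v 4. g x = 2) \<and> v 11 = 1 \<and> v 0 = r"
  let ?c = "store (Plus (Var 14) (Var 4)) base_expr ;; assign 4 (Plus (Var 4) (Num 1))"
  \<comment> \<open>There is no short circuit: once variable 4 reaches the number of vertices, the
    guard also reads the cell behind the table, but the first conjunct is then 0.\<close>
  have guard: "val v a carry_guard \<noteq> 0 \<longleftrightarrow> v 4 < num_vertices E \<and> g (v 4) = 2" if "?I v a" for v a
    using that ready_vars[of E v a] by (auto simp: carry_guard_def ext_expr_def tabulates_def)
  have body: "triple w (\<lambda>v a. ?I v a \<and> val v a carry_guard \<noteq> 0 \<and> num_vertices E - v 4 = k) ?c 30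
      (\<lambda>v a. ?I v a \<and> num_vertices E - v 4 < k)" for k
  proof (rule triple_copy_step[where E = E])
    fix v a assume *: "?I v a \<and> val v a carry_guard \<noteq> 0 \<and> num_vertices E - v 4 = k"
    with guard[of v a] have v: "v 4 < num_vertices E" "g (v 4) = 2" by auto
    with * show "ready E v a \<and> v 4 < num_vertices E" by (simp add: tabulates_def)
    show "?I (v(4 := v 4 + 1)) (a(v 14 + v 4 := base_fun E (v 4))) \<and>
        num_vertices E - (v(4 := v 4 + 1)) 4 < k"
      using * v by (auto simp: tabulates_def ready_array_upd less_Suc_eq)
  qed
  have loop: "triple w (\<lambda>v a. ?I v a \<and> num_vertices E - v 4 \<le> N) carry_code
      (N * (cost N carry_guard + 30 + 2) + cost N carry_guard + 1) (\<lambda>v a. ?I v a \<and> val v a carry_guard = 0)"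
    unfolding carry_code_def
    by (rule triple_while[OF fits_enum(2) _ body]) (simp add: bound_vars_enum)
  show ?thesis
  proof (rule triple_weaken[OF loop])
    show "N * (cost N carry_guard + 30 + 2) + cost N carry_guard + 1 \<le> N * 100 + 100"
      using cost_enum(1)[of N] mult_le_mono2[of "cost N carry_guard + 30 + 2" 100 N] by linarith
  next
    fix v a assume "?I v a \<and> val v a carry_guard = 0"
    with guard[of v a] show "tabulates E (\<lambda>x. if x < v 4 then base_fun E x else g x) v a \<and>
       v 4 \<le> num_vertices E \<and> (\<forall>x<v 4. g x = 2) \<and>
       (v 4 < num_vertices E \<longrightarrow> g (v 4) \<noteq> 2) \<and> v 11 = 1 \<and> v 0 = r"
      by simp
  qed (use assms in auto)
qed

lemma tabulates_upd [simp]: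
  "x \<notin> {2, 3, 12, 13, 14} \<Longrightarrow> tabulates E g (v(x := k)) a \<longleftrightarrow> tabulates E g v a"
  by (simp add: tabulates_def)

text \<open>The loop invariant hides the current candidate under an existential quantifier, whereas
  a single round is verified for a fixed \<open>g\<close>.\<close>

lemma triple_ex:
  assumes "\<And>g. triple w (P g) c T Q"
  shows "triple w (\<lambda>v a. \<exists>g. P g v a) c T Q"
  using assms unfolding triple_def by blast

lemma triple_step:
  fixes E g defines "rk \<equiv> rank (base_fun E) (num_vertices E) g"
  assumes E: "E \<in> erhf_instances" and N: "num_vertices E \<le> N" "num_edges E \<le> N" and g: "extends E g"
  shows "triple w (\<lambda>v a. tabulates E g v a \<and> v 11 = 1 \<and> v 0 = of_bool (found_below E rk))
    step_code (step_time N)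
    (\<lambda>v a. enum_inv E v a \<and> remaining E v a < radix (base_fun E) (num_vertices E) - rk)"
proof -
  let ?n = "num_vertices E" and ?f = "base_fun E"
  let ?found = "\<lambda>v::store. v 11 = 1 \<and> v 0 = of_bool (found_below E (rk + 1))"
  let ?Q = "\<lambda>v a. enum_inv E v a \<and> remaining E v a < radix ?f ?n - rk"
  have g2: "\<forall>x<?n. g x \<le> 2" and f2: "\<forall>x<?n. ?f x \<le> 2"
    using g base_le_two[OF E] by (auto simp: extends_def)
  have rk: "rk < radix ?f ?n"
    unfolding rk_def using rank_less[OF f2 g2] .
  have test: "triple w (\<lambda>v a. tabulates E g v a \<and> v 11 = 1 \<and> v 0 = of_bool (found_below E rk))
      (assign 0 (Or (Var 0) minimal_expr)) (cost N (Or (Var 0) minimal_expr) + 2)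
      (\<lambda>v a. tabulates E g v a \<and> ?found v)"
  proof (rule triple_pre[OF triple_assign[OF fits_enum(1)]])
    fix v a assume *: "tabulates E g v a \<and> v 11 = 1 \<and> v 0 = of_bool (found_below E rk)"
    then have "v 2 \<le> N" "v 3 \<le> N"
      using N ready_vars[of E v a] by (simp_all add: tabulates_def)
    then have "\<forall>y\<in>bound_vars (Or (Var 0) minimal_expr). v y \<le> N"
      using bound_vars_enum(1) by auto
    moreover have "val v a (Or (Var 0) minimal_expr) = of_bool (found_below E (rk + 1))"
      using * val_minimal_expr[OF E g2] found_below_Suc[OF g] by (simp add: rk_def)
    ultimately show "(\<forall>y\<in>bound_vars (Or (Var 0) minimal_expr). v y \<le> N) \<and>
        tabulates E g (v(0 := val v a (Or (Var 0) minimal_expr))) a \<and>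
        ?found (v(0 := val v a (Or (Var 0) minimal_expr)))"
      using * by (simp del: val_connectives)
  qed simp
  have reset: "triple w (\<lambda>v a. tabulates E g v a \<and> ?found v) (assign 4 (Num 0)) (cost N (Num 0) + 2)
      (\<lambda>v a. tabulates E g v a \<and> v 4 = 0 \<and> ?found v)"
    by (rule triple_pre[OF triple_assign]) auto
  let ?P = "\<lambda>v a. tabulates E (\<lambda>x. if x < v 4 then ?f x else g x) v a \<and> v 4 \<le> ?n \<and>
       (\<forall>x<v 4. g x = 2) \<and> (v 4 < ?n \<longrightarrow> g (v 4) \<noteq> 2) \<and> ?found v"
  have incr: "triple w (\<lambda>v a. ?P v a \<and> val v a (Minus (Var 2) (Var 4)) \<noteq> 0)
      (store (Plus (Var 14) (Var 4)) (Plus ext_expr (Num 1)))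
      (cost N (Plus (Var 14) (Var 4)) + cost N (Plus ext_expr (Num 1)) + 3) ?Q"
  proof (rule triple_pre[OF triple_store[OF fits_enum(6,5)]])
    fix v a assume *: "?P v a \<and> val v a (Minus (Var 2) (Var 4)) \<noteq> 0"
    then have r: "ready E v a" by (simp add: tabulates_def)
    define x where "x = v 4"
    have x: "x < ?n" using * ready_vars[OF r] by (simp add: x_def)
    have ax: "a (v 14 + y) = (if y < x then ?f y else g y)" if "y < ?n" for y
      using * that by (simp add: tabulates_def x_def)
    let ?h = "\<lambda>y. if y < x then ?f y else if y = x then g x + 1 else g y"
    let ?a = "a(v 14 + x := g x + 1)"
    have rank: "rank ?f ?n ?h = rk + 1"
      unfolding rk_def using * g by (intro rank_increment[OF x f2]) (auto simp: x_def[symmetric] extends_def x)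
    \<comment> \<open>The carry stopped at \<open>x\<close> because \<open>g x\<close> is not 2, so
      this digit can be raised.\<close>
    have "g x < 2"
      using * x g by (auto simp: x_def extends_def order_less_le)
    then have "extends E ?h"
      using g f2 by (auto simp: extends_def)
    moreover have h: "?a (v 14 + y) = ?h y" if "y < ?n" for y
      using ax[OF that] by simp
    then have "tabulates E ?h v ?a"
      using r by (simp add: tabulates_def ready_array_upd)
    ultimately have "enum_inv E v ?a"
      unfolding enum_inv_def using * rank by (intro exI[of _ ?h]) simp
    moreover have "rank ?f ?n (\<lambda>y. ?a (v 14 + y)) = rk + 1"
      by (rule trans[OF rank_cong rank]) (fact h)
    then have "remaining E v ?a = radix ?f ?n - (rk + 1)"
      unfolding remaining_def using * by simp
    then have "remaining E v ?a < radix ?f ?n - rk"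
      using rk by linarith
    moreover have "val v a (Plus (Var 14) (Var 4)) = v 14 + x" "val v a (Plus ext_expr (Num 1)) = g x + 1"
      using ax[OF x] by (simp_all add: ext_expr_def x_def)
    ultimately show "(\<forall>y\<in>bound_vars (Plus (Var 14) (Var 4)) \<union> bound_vars (Plus ext_expr (Num 1)). v y \<le> N) \<and>
        ?Q v (a(val v a (Plus (Var 14) (Var 4)) := val v a (Plus ext_expr (Num 1))))"
      by (simp only: bound_vars_enum bound_vars.simps) simp
  qed
  have stop: "triple w (\<lambda>v a. ?P v a \<and> val v a (Minus (Var 2) (Var 4)) = 0) (assign 11 (Num 0))
      (cost N (Num 0) + 2) ?Q"
  proof (rule triple_pre[OF triple_assign])
    fix v a assume *: "?P v a \<and> val v a (Minus (Var 2) (Var 4)) = 0"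
    then have r: "ready E v a" by (simp add: tabulates_def)
    have x: "v 4 = ?n" using * ready_vars[OF r] by simp
    \<comment> \<open>Every digit of \<open>g\<close> was 2, so \<open>g\<close> had the largest
      rank and variable 0 already holds the final answer.\<close>
    have "rk + 1 = radix ?f ?n"
      unfolding rk_def using rank_two[OF f2] rank_cong[of ?n g "\<lambda>_. 2" ?f] * x by simp
    then have yes: "v 0 = of_bool (erhf_yes E)"
      using * found_below_radix[OF E] by simp
    \<comment> \<open>The carry has reset all digits, so the table is back at \<open>f\<close>,
      which serves as the witness in \<open>enum_inv\<close>.\<close>
    have "tabulates E ?f v a"
      using * x by (simp add: tabulates_def)
    moreover have "extends E ?f"
      using f2 by (simp add: extends_def)
    ultimately have "enum_inv E (v(11 := 0)) a"
      unfolding enum_inv_def using yes by (intro exI[of _ ?f]) simp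
    then show "(\<forall>y\<in>bound_vars (Num 0). v y \<le> N) \<and>
        ?Q (v(11 := val v a (Num 0))) a"
      using rk by (simp add: remaining_def)
  qed auto
  have finish: "triple w ?P (ite (Minus (Var 2) (Var 4)) (store (Plus (Var 14) (Var 4)) (Plus ext_expr (Num 1)))
       (assign 11 (Num 0))) 50 ?Q"
    by (rule triple_weaken[OF triple_ite[OF _ _ incr stop]]) (auto simp: cost_enum)
  show ?thesis
    unfolding step_code_def
    by (rule triple_weaken[OF triple_seq[OF test triple_seq[OF reset triple_seq[OF triple_carry[OF N(1)] finish]]]])
      (auto simp: step_time_def)
qed

lemma triple_enum:
  assumes E: "E \<in> erhf_instances" and N: "num_vertices E \<le> N" "num_edges E \<le> N"
    and K: "radix (base_fun E) (num_vertices E) \<le> K"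
  shows "triple w (\<lambda>v a. ready E v a \<and> v 0 = 0) enum_code
    (N * 50 + 100 + K * (step_time N + 4)) (\<lambda>v a. v 0 = of_bool (erhf_yes E))"
proof -
  let ?rk = "rank (base_fun E) (num_vertices E)" and ?W = "radix (base_fun E) (num_vertices E)"
  have body: "triple w (\<lambda>v a. enum_inv E v a \<and> val v a (Var 11) \<noteq> 0 \<and> remaining E v a = k)
      step_code (step_time N) (\<lambda>v a. enum_inv E v a \<and> remaining E v a < k)" for k
  proof (rule triple_pre[OF triple_ex])
    \<comment> \<open>The conditions on \<open>g\<close> are part of the precondition, so that
      \<open>triple_ex\<close> applies to every \<open>g\<close>; where they fail, the triple is
      vacuous.\<close>
    let ?P = "\<lambda>g v a. (extends E g \<and> ?W - ?rk g = k) \<and> tabulates E g v a \<and> v 11 = 1 \<and>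
        v 0 = of_bool (found_below E (?rk g))"
    show "triple w (?P g) step_code (step_time N) (\<lambda>v a. enum_inv E v a \<and> remaining E v a < k)" for g
    proof (cases "extends E g \<and> ?W - ?rk g = k")
      case True
      then have g: "extends E g" and k: "?W - ?rk g = k" by auto
      show ?thesis
        by (rule triple_pre[OF triple_step[OF E N g, unfolded k]]) simp
    qed (auto simp: triple_def)
    fix v a assume *: "enum_inv E v a \<and> val v a (Var 11) \<noteq> 0 \<and> remaining E v a = k"
    then obtain g where g: "extends E g" "tabulates E g v a" "v 11 = 1"
        "v 0 = of_bool (found_below E (?rk g))"
      unfolding enum_inv_def by auto
    have "?rk (\<lambda>x. a (v 14 + x)) = ?rk g"
      using g(2) by (intro rank_cong) (simp add: tabulates_def)
    with * g have "?W - ?rk g = k" by (simp add: remaining_def)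
    with g show "\<exists>g. ?P g v a" by blast
  qed
  have loop: "triple w (\<lambda>v a. enum_inv E v a \<and> remaining E v a \<le> K) (while (Var 11) step_code)
      (K * (cost N (Var 11) + step_time N + 2) + cost N (Var 11) + 1)
      (\<lambda>v a. enum_inv E v a \<and> val v a (Var 11) = 0)"
    by (rule triple_while[OF _ _ body]) auto
  have start: "triple w (\<lambda>v a. tabulates E (base_fun E) v a \<and> v 0 = 0) (assign 11 (Num 1)) (cost N (Num 1) + 2)
      (\<lambda>v a. enum_inv E v a \<and> remaining E v a \<le> K)"
  proof (rule triple_pre[OF triple_assign])
    fix v a assume *: "tabulates E (base_fun E) v a \<and> v 0 = 0"
    have "extends E (base_fun E)"
      using base_le_two[OF E] by (simp add: extends_def)
    \<comment> \<open>The enumeration starts at rank 0, where nothing has been tested, so the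
      initial output 0 is right.\<close>
    moreover have "?rk (base_fun E) = 0" by (simp add: rank_def)
    then have "\<not> found_below E (?rk (base_fun E))" by (simp add: found_below_def)
    ultimately have "enum_inv E (v(11 := 1)) a"
      using * unfolding enum_inv_def by (intro exI[of _ "base_fun E"]) simp
    moreover have "remaining E (v(11 := 1)) a \<le> K"
      using K by (simp add: remaining_def)
    ultimately show "(\<forall>y\<in>bound_vars (Num 1). v y \<le> N) \<and>
        enum_inv E (v(11 := val v a (Num 1))) a \<and> remaining E (v(11 := val v a (Num 1))) a \<le> K"
      by simp
  qed auto
  show ?thesis
    unfolding enum_code_def
    by (rule triple_weaken[OF triple_seq[OF triple_init[OF E N(1)] triple_seq[OF start loop]]])
      (auto simp: enum_inv_def algebra_simps)
qed

section \<open>Computability of the factor \<open>3 ^ k\<close>\<close>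

text \<open>The argument \<open>k\<close> arrives in unary, so tripling variable 0 once per symbol,
  by two additions, yields \<open>3 ^ k\<close>.\<close>

definition power_code :: code where
  "power_code = assign 0 (Num 1) ;; input 15 8 ;;
     while (Minus (Num 2) (Var 15))
       (assign 0 (Plus (Var 0) (Plus (Var 0) (Var 0))) ;; assign 8 (Plus (Var 8) (Num 1)) ;; input 15 8)"

lemma ram_computable_power: "ram_computable (\<lambda>k. 3 ^ k)"
  unfolding ram_computable_def
proof (intro exI[of _ "assemble 0 power_code"] allI)
  fix k :: nat
  let ?w = "replicate k True"
  let ?I = "\<lambda>(v::store) (a::store). v 0 = 3 ^ v 8 \<and> v 8 \<le> k \<and> v 15 = input_symbol ?w (v 8)"
  let ?e = "Minus (Num 2) (Var 15)"
  let ?c = "assign 0 (Plus (Var 0) (Plus (Var 0) (Var 0))) ;; assign 8 (Plus (Var 8) (Num 1)) ;; input 15 8"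
  have body: "triple ?w (\<lambda>v a. ?I v a \<and> val v a ?e \<noteq> 0 \<and> k - v 8 = j) ?c
      (cost 0 (Plus (Var 0) (Plus (Var 0) (Var 0))) + 2 + (cost 0 (Plus (Var 8) (Num 1)) + 2 + 1))
      (\<lambda>v a. ?I v a \<and> k - v 8 < j)" for j
    by (rule triple_pre[OF triple_seq[OF triple_assign triple_seq[OF triple_assign triple_input]]])
      (auto simp: input_symbol_def split: if_splits)
  let ?T = "cost 0 (Plus (Var 0) (Plus (Var 0) (Var 0))) + 2 + (cost 0 (Plus (Var 8) (Num 1)) + 2 + 1)"
  have loop: "triple ?w (\<lambda>v a. ?I v a \<and> k - v 8 \<le> k) (while ?e ?c) (k * (cost 0 ?e + ?T + 2) + cost 0 ?e + 1)
      (\<lambda>v a. ?I v a \<and> val v a ?e = 0)"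
    by (rule triple_while[OF _ _ body]) auto
  have "triple ?w (\<lambda>v a. v = (\<lambda>_. 0) \<and> a = (\<lambda>_. 0)) power_code
      (cost 0 (Num 1) + 2 + (1 + (k * (cost 0 ?e + ?T + 2) + cost 0 ?e + 1))) (\<lambda>v a. v 0 = 3 ^ k)"
    unfolding power_code_def
    by (rule triple_weaken[OF triple_seq[OF triple_assign triple_seq[OF triple_input loop]]])
      (auto simp: input_symbol_def split: if_splits)
  then show "\<exists>t. outputs_within (assemble 0 power_code) ?w t (3 ^ k)"
    by (blast intro: outputs_within_triple)
qed

section \<open>Tractability from a computable upper bound on the number of free vertices\<close>

lemma size_le_length_encode:
  assumes "w = erhf_encode E"
  shows "num_vertices E \<le> length w" "num_edges E \<le> length w"
proof -
  have "{num_vertices E, num_edges E} \<subseteq> set (erhf_code E)"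
    by (simp add: erhf_code_def)
  then show "num_vertices E \<le> length w" "num_edges E \<le> length w"
    using entry_le_length_concat_unary[of _ "erhf_code E"] by (auto simp: assms erhf_encode_def)
qed

text \<open>The expression \<open>e\<close> is needed to compute the parameter in polynomial time;
  for the decision only \<open>free\<close> counts, which bounds the rounds of
  \<open>enum_code\<close> by \<open>3 ^ \<kappa> E\<close>.\<close>

lemma fpt_erhf:
  assumes fits: "fits 20 e" and bounds: "bound_vars e \<subseteq> {2, 3}"
    and val: "\<And>E v a. E \<in> erhf_instances \<Longrightarrow> ready E v a \<Longrightarrow> val v a e = \<kappa> E"
    and free: "\<And>E. E \<in> erhf_instances \<Longrightarrow> card {x. x < num_vertices E \<and> base_fun E x < 2} \<le> \<kappa> E"
  shows "fpt erhf_language (erhf_parameter \<kappa>)"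
proof -
  have "poly_bounded (\<lambda>N. front_time N + (cost N e + 2))"
    by (intro poly_bounded_intros poly_bounded_front_time)
  then obtain p :: "nat poly" where p: "\<And>N. front_time N + (cost N e + 2) \<le> poly p N"
    unfolding poly_bounded_def by blast
  have param: "outputs_within (assemble 0 (on_instance (assign 0 e))) w (poly p (length w)) (erhf_parameter \<kappa> w)" for w
  proof (cases "w \<in> erhf_encode ` erhf_instances")
    case True
    then obtain E where E: "E \<in> erhf_instances" "w = erhf_encode E" by blast
    have "triple w (\<lambda>v a. ready E v a \<and> v 0 = 0 \<and> v 2 \<le> length w \<and> v 3 \<le> length w) (assign 0 e)
        (cost (length w) e + 2) (\<lambda>v a. v 0 = \<kappa> E)"
      by (rule triple_pre[OF triple_assign[OF fits]]) (use bounds val[OF E(1)] in auto)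
    from on_instance_valid[OF E this] p have "outputs_within (assemble 0 (on_instance (assign 0 e))) w
        (poly p (length w)) (\<kappa> E)"
      by (rule outputs_within_triple)
    then show ?thesis using erhf_parameter_encode[OF E(1), of \<kappa>] E(2) by simp
  next
    case False
    have "front_time (length w) \<le> poly p (length w)"
      using p[of "length w"] by linarith
    with on_instance_invalid[OF False] have "outputs_within (assemble 0 (on_instance (assign 0 e))) w
        (poly p (length w)) 0"
      by (rule outputs_within_triple)
    then show ?thesis using False by (simp add: erhf_parameter_def)
  qed
  have "poly_bounded (\<lambda>N. front_time N + N * 50 + 100 + step_time N + 4)"
    unfolding step_time_def by (intro poly_bounded_intros poly_bounded_front_time)
  then obtain q :: "nat poly" where q: "\<And>N. front_time N + N * 50 + 100 + step_time N + 4 \<le> poly q N"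
    unfolding poly_bounded_def by blast
  have decide: "outputs_within (assemble 0 (on_instance enum_code)) w
      (3 ^ erhf_parameter \<kappa> w * poly q (length w)) (if w \<in> erhf_language then 1 else 0)" for w
  proof (cases "w \<in> erhf_encode ` erhf_instances")
    case True
    then obtain E where E: "E \<in> erhf_instances" "w = erhf_encode E" by blast
    let ?N = "length w"
    have "radix (base_fun E) (num_vertices E) \<le> 3 ^ card {x. x < num_vertices E \<and> base_fun E x < 2}"
      by (rule radix_le)
    also have "\<dots> \<le> 3 ^ \<kappa> E"
      using free[OF E(1)] by (intro power_increasing) auto
    finally have "triple w (\<lambda>v a. ready E v a \<and> v 0 = 0 \<and> v 2 \<le> ?N \<and> v 3 \<le> ?N) enum_code
        (?N * 50 + 100 + 3 ^ \<kappa> E * (step_time ?N + 4)) (\<lambda>v a. v 0 = of_bool (erhf_yes E))"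
      by (intro triple_pre[OF triple_enum[OF E(1) size_le_length_encode[OF E(2)]]]) auto
    note t = on_instance_valid[OF E this]
    \<comment> \<open>The time has the form \<open>A + K * B\<close>, but \<open>fpt\<close> wants a
      product; as \<open>K\<close> is a power of 3, it is at least 1 and can also multiply
      \<open>A\<close>.\<close>
    have le: "A + K * B \<le> K * (A + B)" if "1 \<le> K" for A B K :: nat
      using mult_le_mono1[OF that, of A] by (simp add: add_mult_distrib2)
    have "front_time ?N + (?N * 50 + 100 + 3 ^ \<kappa> E * (step_time ?N + 4)) =
        (front_time ?N + ?N * 50 + 100) + 3 ^ \<kappa> E * (step_time ?N + 4)"
      by simp
    also have "\<dots> \<le> 3 ^ \<kappa> E * (front_time ?N + ?N * 50 + 100 + (step_time ?N + 4))"
      by (rule le) simp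
    also have "\<dots> = 3 ^ \<kappa> E * (front_time ?N + ?N * 50 + 100 + step_time ?N + 4)"
      by simp
    also have "\<dots> \<le> 3 ^ \<kappa> E * poly q ?N"
      by (intro mult_le_mono2 q)
    finally have "outputs_within (assemble 0 (on_instance enum_code)) w (3 ^ \<kappa> E * poly q ?N) (of_bool (erhf_yes E))"
      by (rule outputs_within_triple[OF t])
    then show ?thesis
      using erhf_parameter_encode[OF E(1), of \<kappa>] erhf_encode_in_language[OF E(1)] E(2)
      by (simp add: of_bool_def)
  next
    case False
    \<comment> \<open>A string that encodes no instance has parameter 0, so the factor is
      \<open>3 ^ 0\<close> and the polynomial alone has to cover the front end.\<close>
    have "front_time (length w) \<le> 3 ^ erhf_parameter \<kappa> w * poly q (length w)"
      using q[of "length w"] False by (simp add: erhf_parameter_def)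
    with on_instance_invalid[OF False] have "outputs_within (assemble 0 (on_instance enum_code)) w
        (3 ^ erhf_parameter \<kappa> w * poly q (length w)) 0"
      by (rule outputs_within_triple)
    moreover have "w \<notin> erhf_language"
      using False by (auto simp: erhf_language_def)
    ultimately show ?thesis by simp
  qed
  show ?thesis
    unfolding fpt_def poly_time_computable_def
    using param decide ram_computable_power by blast
qed

theorem theorem17:
  "fpt erhf_language (erhf_parameter (\<lambda>E. weight_two_minus (verts E) (base_fun E))) \<and>
   fpt erhf_language (erhf_parameter (\<lambda>E. num_below_two (verts E) (base_fun E)))"
proof
  have below: "{x. x < n \<and> f x < 2} = {x \<in> {..<n}. f x \<in> {0, 1}}" for f :: "nat \<Rightarrow> nat" and n
    by auto
  have base: "val (v(4 := x)) a base_expr = base_fun E x" if "ready E v a" "x < num_vertices E" for E v a x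
    using ready_val(3)[of E "v(4 := x)" a] that by simp
  show "fpt erhf_language (erhf_parameter (\<lambda>E. weight_two_minus (verts E) (base_fun E)))"
  proof (rule fpt_erhf[where e = "Sum 4 2 (Minus (Num 2) base_expr)"])
    fix E v a assume "ready E v a"
    then show "val v a (Sum 4 2 (Minus (Num 2) base_expr)) = weight_two_minus (verts E) (base_fun E)"
      by (simp add: weight_two_minus_def verts_def ready_vars base)
  next
    fix E :: erhf_instance
    have "card {x. x < num_vertices E \<and> base_fun E x < 2} = (\<Sum>x<num_vertices E. of_bool (base_fun E x < 2))"
      by (simp add: of_bool_def sum.If_cases Int_def)
    \<comment> \<open>Each vertex with \<open>f x < 2\<close> contributes at least 1 to the
      weight.\<close>
    also have "\<dots> \<le> weight_two_minus (verts E) (base_fun E)"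
      unfolding weight_two_minus_def verts_def by (intro sum_mono) auto
    finally show "card {x. x < num_vertices E \<and> base_fun E x < 2} \<le> weight_two_minus (verts E) (base_fun E)" .
  qed (use fits_enum bound_vars_enum in \<open>auto simp: base_expr_def\<close>)
  show "fpt erhf_language (erhf_parameter (\<lambda>E. num_below_two (verts E) (base_fun E)))"
  proof (rule fpt_erhf[where e = "Sum 4 2 (Le base_expr (Num 1))"])
    fix E v a assume r: "ready E v a"
    have "val v a (Sum 4 2 (Le base_expr (Num 1))) = (\<Sum>x<num_vertices E. of_bool (base_fun E x \<le> 1))"
      by (simp add: ready_vars[OF r] base[OF r])
    also have "\<dots> = num_below_two (verts E) (base_fun E)"
      unfolding num_below_two_def verts_def below[symmetric]
      by (simp add: of_bool_def sum.If_cases Int_def less_Suc_eq_le numeral_2_eq_2)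
    finally show "val v a (Sum 4 2 (Le base_expr (Num 1))) = num_below_two (verts E) (base_fun E)" .
  next
    show "card {x. x < num_vertices E \<and> base_fun E x < 2} \<le> num_below_two (verts E) (base_fun E)" for E
      unfolding num_below_two_def verts_def below ..
  qed (auto simp: base_expr_def connective_defs)
qed

end
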